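(* Let $\omega,\pi:[0,a]\to[0,b]$ be continuous non-increasing functions with $\pi(x)\le\omega(x)$ for all $x\in[0,a]$, and suppose that $\operatorname{area}(\omega/\pi)=1$. Let $\{\upsilon_n=\lambda^{(n)}/\mu^{(n)}\}$ be a sequence of connected skew shapes with strongly stable shape $\omega/\pi$, i.e. $\lambda^{(n)}\mapsto\omega$ and $\mu^{(n)}\mapsto\pi$. Then, as $n\to\infty$, $$-\bigl(1+c(\omega/\pi)\bigr)n+o(n)\ \le\ \log e(\upsilon_n)-\frac12\,n\log n\ \le\ -\bigl(1+c(\omega/\pi)\bigr)n+\log\xi(\upsilon_n)+o(n),$$ where $$c(\omega/\pi)=\iint_{\mathcal{C}}\log\hslash(x,y)\,dx\,dy.$$
   Context: $e(\lambda/\mu)$ is the number of standard Young tableaux of skew shape $\lambda/\mu$; $\log$ is the natural logarithm. $\mathcal{C}=\mathcal{C}(\omega/\pi)=\{(x,y):0\le x\le a,\ \pi(x)\le y\le\omega(x)\}$ and $\operatorname{area}(\omega/\pi)$ is its area. Strongly stable shape: place the Young diagram of $\lambda$ as the region $[\lambda]=\bigcup_{i}[i-1,i]\times[0,\lambda_i]$ in the quadrant $\mathbb{R}_+^2$, and for $s>0$ let $s\omega$ denote the dilation by $s$ (in both directions) of the region $\{(x,y):0\le x\le a,\ 0\le y\le\omega(x)\}$. A sequence $\{\lambda^{(n)}\}$ has strongly stable shape $\omega$, written $\lambda^{(n)}\mapsto\omega$, if there is a constant $L>0$ such that for all sufficiently large $n$ the region $[\lambda^{(n)}]$ contains $(\sqrt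 n-L)\omega$ and is contained in $(\sqrt n+L)\omega$ (i.e. the boundary of $\lambda^{(n)}$ lies between the boundaries of these two dilated shapes). Hook function: $\hslash:\mathcal{C}\to\mathbb{R}_+$ is the scaling limit of the hook-lengths $h$ of $\lambda^{(n)}$, $\hslash(x,y)=\lim_{n\to\infty}\frac{1}{\sqrt n}\,h(\lfloor x\sqrt n\rfloor,\lfloor y\sqrt n\rfloor)$, that is, $\hslash(x,y)=(\omega(x)-y)+(\omega^{-1}(y)-x)$ (for almost every $(x,y)\in\mathcal C$), where $\omega^{-1}(y)=\sup\{x\in[0,a]:\omega(x)\ge y\}$. Excited diagrams: let $D$ be a subset of the Young diagram of $\lambda$. A cell $(i,j)\in D$ is active if $(i+1,j)$, $(i,j+1)$ and $(i+1,j+1)$ are all in $\lambda\setminus D$. An excited move replaces an active cell $(i,j)$ of $D$ by $(i+1,j+1)$. An excited diagram of $\lambda/\mu$ is a subset of cells of $\lambda$ obtained from the Young diagram of $\mu$ by a (possibly empty) sequence of excited moves. $\xi(\lambda/\mu)$ denotes the number of excited diagrams of $\lambda/\mu$. *)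

theory Defs
  imports "HOL-Analysis.Analysis" "HOL-Library.Landau_Symbols"
begin

section \<open>Partitions and skew shapes\<close>

text \<open>Rows and columns are indexed from 0: \<open>p i\<close> is the (i+1)-st part, with all
  parts beyond the length of the partition equal to 0.\<close>

definition partition :: "(nat \<Rightarrow> nat) \<Rightarrow> bool" where
  "partition p \<longleftrightarrow> antimono p \<and> finite {i. p i \<noteq> 0}"

definition diagram :: "(nat \<Rightarrow> nat) \<Rightarrow> (nat \<times> nat) set" where
  "diagram p = {(i, j). j < p i}"

definition skew_shape :: "(nat \<Rightarrow> nat) \<Rightarrow> (nat \<Rightarrow> nat) \<Rightarrow> bool" where
  "skew_shape p q \<longleftrightarrow> partition p \<and> partition q \<and> diagram q \<subseteq> diagram p"

definition skew_cells :: "(nat \<Rightarrow> nat) \<Rightarrow> (nat \<Rightarrow> nat) \<Rightarrow> (nat \<times> nat) set" where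
  "skew_cells p q = diagram p - diagram q"

text \<open>Cells are adjacent when they share an edge (not just a corner).\<close>

definition adjacent :: "nat \<times> nat \<Rightarrow> nat \<times> nat \<Rightarrow> bool" where
  "adjacent c d \<longleftrightarrow>
     d = (Suc (fst c), snd c) \<or> d = (fst c, Suc (snd c)) \<or>
     c = (Suc (fst d), snd d) \<or> c = (fst d, Suc (snd d))"

definition connected_cells :: "(nat \<times> nat) set \<Rightarrow> bool" where
  "connected_cells S \<longleftrightarrow>
     (\<forall>c\<in>S. \<forall>d\<in>S. (c, d) \<in> {(u, v). u \<in> S \<and> v \<in> S \<and> adjacent u v}\<^sup>*)"

definition connected_skew_shape :: "(nat \<Rightarrow> nat) \<Rightarrow> (nat \<Rightarrow> nat) \<Rightarrow> bool" where
  "connected_skew_shape p q \<longleftrightarrow> skew_shape p q \<and> connected_cells (skew_cells p q)"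

section \<open>Standard Young tableaux\<close>

text \<open>Tableaux are made \<open>undefined\<close> off the shape, so that distinct functions are
  distinct tableaux.\<close>

definition SYT :: "(nat \<Rightarrow> nat) \<Rightarrow> (nat \<Rightarrow> nat) \<Rightarrow> (nat \<times> nat \<Rightarrow> nat) set" where
  "SYT p q = {T. T \<in> extensional (skew_cells p q) \<and>
     bij_betw T (skew_cells p q) {1..card (skew_cells p q)} \<and>
     (\<forall>i j j'. (i, j) \<in> skew_cells p q \<and> (i, j') \<in> skew_cells p q \<and> j < j'
        \<longrightarrow> T (i, j) < T (i, j')) \<and>
     (\<forall>i i' j. (i, j) \<in> skew_cells p q \<and> (i', j) \<in> skew_cells p q \<and> i < i'
        \<longrightarrow> T (i, j) < T (i', j))}"

definition num_SYT :: "(nat \<Rightarrow> nat) \<Rightarrow> (nat \<Rightarrow> nat) \<Rightarrow> nat" where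
  "num_SYT p q = card (SYT p q)"

section \<open>Excited diagrams\<close>

definition active :: "(nat \<Rightarrow> nat) \<Rightarrow> (nat \<times> nat) set \<Rightarrow> nat \<times> nat \<Rightarrow> bool" where
  "active p D c \<longleftrightarrow> c \<in> D \<and>
     {(Suc (fst c), snd c), (fst c, Suc (snd c)), (Suc (fst c), Suc (snd c))} \<subseteq> diagram p - D"

inductive_set excited_diagrams ::
  "(nat \<Rightarrow> nat) \<Rightarrow> (nat \<Rightarrow> nat) \<Rightarrow> (nat \<times> nat) set set"
  for p q :: "nat \<Rightarrow> nat" where
  start: "diagram q \<in> excited_diagrams p q"
| move: "D \<in> excited_diagrams p q \<Longrightarrow> active p D (i, j) \<Longrightarrow>
     insert (Suc i, Suc j) (D - {(i, j)}) \<in> excited_diagrams p q"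

definition num_excited :: "(nat \<Rightarrow> nat) \<Rightarrow> (nat \<Rightarrow> nat) \<Rightarrow> nat" where
  "num_excited p q = card (excited_diagrams p q)"

section \<open>Strongly stable shapes\<close>

text \<open>The union is over all rows, including the empty ones, so the region always contains
  the half-line \<open>y = 0\<close>, \<open>x \<ge> 0\<close>.\<close>

definition young_region :: "(nat \<Rightarrow> nat) \<Rightarrow> (real \<times> real) set" where
  "young_region p = (\<Union>i. {real i..real i + 1} \<times> {0..real (p i)})"

definition subgraph :: "real \<Rightarrow> (real \<Rightarrow> real) \<Rightarrow> (real \<times> real) set" where
  "subgraph a f = {(x, y). 0 \<le> x \<and> x \<le> a \<and> 0 \<le> y \<and> y \<le> f x}"

text \<open>The inclusions are read modulo the axis \<open>y = 0\<close>, on which both regions are degenerate: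
  a shape function may vanish on part (or all) of \<open>[0, a]\<close>, and a partition may have
  fewer than \<open>a\<close> times \<open>sqrt n\<close> nonzero parts. Since \<open>young_region\<close>
  already contains the axis, only the second inclusion has to mention it.\<close>

definition strongly_stable ::
  "real \<Rightarrow> (real \<Rightarrow> real) \<Rightarrow> (nat \<Rightarrow> nat \<Rightarrow> nat) \<Rightarrow> bool" where
  "strongly_stable a f p \<longleftrightarrow> (\<exists>L>0. \<forall>\<^sub>F n in sequentially.
     (\<lambda>z. (sqrt (real n) - L) *\<^sub>R z) ` subgraph a f \<subseteq> young_region (p n) \<and>
     young_region (p n) \<subseteq>
       (\<lambda>z. (sqrt (real n) + L) *\<^sub>R z) ` subgraph a f \<union> {(x, y). y = 0})"

section \<open>The limit region and the hook function\<close>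

definition skew_region :: "real \<Rightarrow> (real \<Rightarrow> real) \<Rightarrow> (real \<Rightarrow> real) \<Rightarrow> (real \<times> real) set" where
  "skew_region a \<omega> \<pi> = {(x, y). 0 \<le> x \<and> x \<le> a \<and> \<pi> x \<le> y \<and> y \<le> \<omega> x}"

definition area :: "(real \<times> real) set \<Rightarrow> real" where
  "area S = measure lborel S"

definition shape_inverse :: "real \<Rightarrow> (real \<Rightarrow> real) \<Rightarrow> real \<Rightarrow> real" where
  "shape_inverse a \<omega> y = Sup {x \<in> {0..a}. \<omega> x \<ge> y}"

text \<open>The scaling limit of the hook lengths of a sequence of partitions with strongly stable
  shape \<open>\<omega>\<close>: arm plus leg.\<close>

definition hook_function :: "real \<Rightarrow> (real \<Rightarrow> real) \<Rightarrow> real \<times> real \<Rightarrow> real" where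
  "hook_function a \<omega> = (\<lambda>(x, y). (\<omega> x - y) + (shape_inverse a \<omega> y - x))"

definition c_const :: "real \<Rightarrow> (real \<Rightarrow> real) \<Rightarrow> (real \<Rightarrow> real) \<Rightarrow> real" where
  "c_const a \<omega> \<pi> = (LINT z:skew_region a \<omega> \<pi>|lborel. ln (hook_function a \<omega> z))"

end

theory Submission
  imports Defs
begin

text \<open>Let \<open>H\<close> be the product of the hook lengths over the \<open>m\<close> cells of \<open>\<lambda>/\<mu>\<close>. Naruse's formula writes
  \<open>e(\<lambda>/\<mu>)\<close> as \<open>m!\<close> times a sum over excited diagrams of reciprocal hook products; the diagram of \<open>\<mu>\<close>
  contributes the largest summand \<open>1/H\<close>, so \<open>m! \<le> e(\<lambda>/\<mu>) H \<le> m! \<xi>(\<lambda>/\<mu>)\<close>. Only these two inequalities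
  are needed. They follow from a function \<open>G\<close> of \<open>\<mu>\<close> which obeys the Pieri rule
  \<open>|\<lambda>/\<mu>| G(\<mu>) = \<Sum> G(\<nu>)\<close>, the sum being over the \<open>\<nu>\<close> obtained by adding a cell to \<open>\<mu>\<close>; it is built up
  by adding the cells of \<open>\<lambda>\<close> one corner at a time.

  Strong stability gives \<open>m = n + O(sqrt n)\<close>, so Stirling's formula reduces the theorem to
  \<open>(1/n) \<Sum> ln (h(u) / sqrt n) \<rightarrow> c(\<omega>/\<pi>)\<close>. The logarithmic singularity along the outer boundary is
  straightened by measuring the height of a cell downwards from the end of its row: at distance \<open>t\<close> the
  scaled hook length is at least \<open>t\<close>, so \<open>|ln t| + const\<close> dominates, and the shear
  \<open>(x, t) \<mapsto> (x, \<omega> x - t)\<close> preserves Lebesgue measure.\<close>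

section \<open>Adding and removing cells\<close>

text \<open>Removing a corner changes the hook lengths in its whole row and column, so a Pieri rule
  phrased in hook lengths does not survive an induction on \<lambda>. The induction therefore uses
  free weights \<open>x i + y j\<close>, hook lengths being one specialization; only the labelling
  \<open>z\<close> of the boundary steps changes, by transposing two neighbours. Up to conventions,
  G(\<mu>) is the localization at \<lambda> of an equivariant Schubert class of a Grassmannian, the
  Pieri rule is the equivariant Chevalley formula, and adding a corner is the recursion behind the
  AJS-Billey formula. Equality with the excited sum would need a description of all excited
  diagrams; the upper bound gets by with two disjoint families inside the whole set, and the lower
  bound with the summand of \<mu>.

  On the analytic side the leg lengths are delicate: column lengths are shown to converge only at
  heights where \<omega> has no plateau, and the exceptional heights must contribute a null set. The
  error O(sqrt n) in the size is what makes the multiple of ln n in Stirling's formula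
  harmless.\<close>

definition conjugate :: "(nat \<Rightarrow> nat) \<Rightarrow> nat \<Rightarrow> nat" where
  "conjugate p j = card {i. j < p i}"

definition hook :: "(nat \<Rightarrow> nat) \<Rightarrow> nat \<times> nat \<Rightarrow> nat" where
  "hook p = (\<lambda>(i, j). (p i - j) + (conjugate p j - i) - 1)"

text \<open>\<open>edge p i\<close> is the content of the first cell to the right of row \<open>i\<close>; it labels the vertical
  boundary step of that row.\<close>

definition edge :: "(nat \<Rightarrow> nat) \<Rightarrow> nat \<Rightarrow> int" where
  "edge p i = int (p i) - int i"

text \<open>All shapes stay inside the first \<open>N\<close> rows, where the outer shape lives, so
  a cell opening row \<open>N\<close> is deliberately excluded.\<close>

definition addable :: "nat \<Rightarrow> (nat \<Rightarrow> nat) \<Rightarrow> nat set" where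
  "addable N p = {i. i < N \<and> (i = 0 \<or> p i < p (i - 1))}"

text \<open>\<open>k\<close> is the content of the removable cell, which is the last one of row \<open>r\<close>; there is at most one
  such \<open>r\<close> for each \<open>k\<close>.\<close>

definition removable_at :: "int \<Rightarrow> (nat \<Rightarrow> nat) \<Rightarrow> nat \<Rightarrow> bool" where
  "removable_at k p r \<longleftrightarrow> edge p r = k + 1 \<and> p (Suc r) < p r"

definition add_cell :: "(nat \<Rightarrow> nat) \<Rightarrow> nat \<Rightarrow> nat \<Rightarrow> nat" where
  "add_cell p i = p(i := Suc (p i))"

definition del_cell :: "(nat \<Rightarrow> nat) \<Rightarrow> nat \<Rightarrow> nat \<Rightarrow> nat" where
  "del_cell p i = p(i := p i - 1)"

definition bounded_partition :: "nat \<Rightarrow> (nat \<Rightarrow> nat) \<Rightarrow> bool" where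
  "bounded_partition N p \<longleftrightarrow> antimono p \<and> (\<forall>i\<ge>N. p i = 0)"

text \<open>The simple reflection exchanging positions \<open>k\<close> and \<open>k + 1\<close> of
  the boundary sequence, kept only when it shortens the shape. On antitone \<open>p\<close> the
  description is well defined by \<open>removable_at_unique\<close>.\<close>

definition tail_term :: "int \<Rightarrow> ((nat \<Rightarrow> nat) \<Rightarrow> real) \<Rightarrow> (nat \<Rightarrow> nat) \<Rightarrow> real" where
  "tail_term k G p = (if \<exists>r. removable_at k p r then G (del_cell p (THE r. removable_at k p r)) else 0)"

lemma partition_imp_bounded: "partition p \<Longrightarrow> \<exists>N. bounded_partition N p"
proof -
  assume p: "partition p"
  then obtain N where "\<forall>i\<in>{i. p i \<noteq> 0}. i < N"
    unfolding partition_def using finite_nat_set_iff_bounded by blast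
  then show ?thesis using p unfolding partition_def bounded_partition_def
    by (metis (mono_tags, lifting) linorder_not_less mem_Collect_eq)
qed

lemma bounded_partition_imp_partition: "bounded_partition N p \<Longrightarrow> partition p"
  unfolding bounded_partition_def partition_def
  by (auto intro!: finite_subset[of "{i. 0 < p i}" "{..<N}"]) (metis less_irrefl linorder_not_less)

lemma bounded_partition_mono: "bounded_partition N p \<Longrightarrow> N \<le> M \<Longrightarrow> bounded_partition M p"
  unfolding bounded_partition_def by auto

lemma antimono_SucI: "(\<And>i. p (Suc i) \<le> p i) \<Longrightarrow> antimono (p :: nat \<Rightarrow> nat)"
  by (simp add: antimono_iff_le_Suc)

text \<open>The rows longer than \<open>j\<close> form an initial segment, ending at the least row
  \<open>m\<close> that is not longer. Column lengths are handled through this equivalence from here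
  on.\<close>

lemma less_conjugate_iff:
  assumes "partition p"
  shows "i < conjugate p j \<longleftrightarrow> j < p i"
proof -
  obtain N where N: "bounded_partition N p" using partition_imp_bounded assms by blast
  define m where "m = (LEAST i. \<not> j < p i)"
  have ex: "\<not> j < p N" using N by (auto simp: bounded_partition_def)
  have "\<not> j < p m" unfolding m_def by (rule LeastI[of "\<lambda>i. \<not> j < p i"]) (rule ex)
  moreover have "j < p i" if "i < m" for i using not_less_Least[of i "\<lambda>i. \<not> j < p i"] that
    by (auto simp: m_def)
  moreover have "p i \<le> p m" if "i \<ge> m" for i using assms that by (auto simp: partition_def antimono_def)
  ultimately have "{i. j < p i} = {..<m}"
    by (auto; metis le_less_trans linorder_not_less)
  then show ?thesis unfolding conjugate_def using \<open>{i. j < p i} = {..<m}\<close> by auto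
qed

section \<open>Boundary labels of the rows, and the Pieri rule under a transposition of
  labels\<close>

lemma edge_less:
  assumes "antimono p" "i < j" shows "edge p j < edge p i"
proof -
  have "p j \<le> p i" using assms by (simp add: antimono_def)
  then show ?thesis using assms(2) by (simp add: edge_def)
qed

lemma edge_inj: "antimono p \<Longrightarrow> edge p i = edge p j \<longleftrightarrow> i = j"
  by (metis edge_less linorder_neqE_nat order_less_irrefl)

lemma edge_le: "antimono p \<Longrightarrow> i \<le> j \<Longrightarrow> edge p j \<le> edge p i"
  by (metis edge_less le_less order_le_less)

lemma removable_at_unique: "antimono p \<Longrightarrow> removable_at k p r \<Longrightarrow> removable_at k p s \<Longrightarrow> r = s"
  by (metis edge_inj removable_at_def)

lemma tail_term_removable:
  assumes "antimono p" "removable_at k p r"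
  shows "tail_term k G p = G (del_cell p r)"
proof -
  have "(THE r. removable_at k p r) = r"
    using assms removable_at_unique by blast
  then show ?thesis using assms(2) unfolding tail_term_def by auto
qed

lemma tail_term_0: "(\<And>r. \<not> removable_at k p r) \<Longrightarrow> tail_term k G p = 0"
  by (simp add: tail_term_def)

lemma bounded_partition_add_cell:
  assumes "bounded_partition N p" "i \<in> addable N p" shows "bounded_partition N (add_cell p i)"
proof -
  have a: "p (Suc j) \<le> p j" for j using assms(1) by (simp add: bounded_partition_def antimono_iff_le_Suc)
  have "antimono (add_cell p i)"
  proof (rule antimono_SucI)
    fix j show "add_cell p i (Suc j) \<le> add_cell p i j"
      using a[of j] assms(2) by (auto simp: add_cell_def addable_def)
  qed
  then show ?thesis using assms by (auto simp: bounded_partition_def add_cell_def addable_def)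
qed

lemma bounded_partition_del_cell:
  assumes "bounded_partition N p" "p (Suc i) < p i" shows "bounded_partition N (del_cell p i)"
proof -
  have a: "p (Suc j) \<le> p j" for j using assms(1) by (simp add: bounded_partition_def antimono_iff_le_Suc)
  have "antimono (del_cell p i)"
  proof (rule antimono_SucI)
    fix j show "del_cell p i (Suc j) \<le> del_cell p i j"
      using a[of j] assms(2) by (auto simp: del_cell_def)
  qed
  then show ?thesis using assms by (auto simp: bounded_partition_def del_cell_def)
qed

lemma sum_edge_delta:
  assumes "antimono p"
  shows "(\<Sum>i<N. if edge p i = v then w else 0) = (if \<exists>i<N. edge p i = v then w else (0::real))"
proof (cases "\<exists>i<N. edge p i = v")
  case True
  then obtain i where i: "i < N" "edge p i = v" by blast
  have "edge p l = v \<longleftrightarrow> l = i" for l using edge_inj[OF assms] i(2) by metis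
  then show ?thesis using i by (auto simp: sum.delta)
qed auto

lemma removable_row_bound:
  assumes "bounded_partition N p" "p (Suc r) < p r" shows "r < N"
  using assms by (metis bounded_partition_def linorder_not_less not_less0)

text \<open>At a removable corner of content \<open>k\<close> the label \<open>k + 1\<close> belongs
  to a row and \<open>k\<close> to a column. The next lemma is the mirror image for an addable
  corner.\<close>

lemma no_edge_below_removable:
  assumes "antimono p" "removable_at k p r"
  shows "edge p i \<noteq> k"
proof
  assume i: "edge p i = k"
  then have "\<not> i \<le> r" using edge_le[OF assms(1), of i r] assms(2) by (auto simp: removable_at_def)
  then have "edge p i \<le> edge p (Suc r)" by (intro edge_le assms) auto
  then show False using assms(2) i by (auto simp: removable_at_def edge_def)
qed

lemma no_edge_above_addable:
  assumes "antimono p" "i \<in> addable N p" "edge p i = k"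
  shows "edge p l \<noteq> k + 1"
proof
  assume l: "edge p l = k + 1"
  then have "\<not> i \<le> l" using edge_le[OF assms(1), of i l] assms(3) by auto
  then have i: "i \<noteq> 0" "l \<le> i - 1" by auto
  then have "edge p (i - 1) \<le> edge p l" by (intro edge_le assms) auto
  then show False using assms(2,3) l i by (auto simp: addable_def edge_def)
qed

text \<open>Passing from \<open>z0\<close> to \<open>z\<close> swaps the labels at \<open>k\<close> and \<open>k + 1\<close>, which is what adding a corner of
  content \<open>k\<close> to the outer shape does to its boundary.\<close>

lemma pieri_step:
  fixes G :: "(nat \<Rightarrow> nat) \<Rightarrow> real"
  assumes IH: "\<And>p. bounded_partition N p \<Longrightarrow>
      (\<Sum>i<N. x i - z0 (edge p i)) * G p = (\<Sum>i\<in>addable N p. G (add_cell p i))"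
    and z: "\<And>v. z v - z0 v = (if v = k + 1 then w else if v = k then - w else 0)"
    and z0: "z0 (k + 1) - z0 k = - w"
    and k: "- int N < k" and p: "bounded_partition N p"
    and H_def: "\<And>p. H p = G p + w * tail_term k G p"
  shows "(\<Sum>i<N. x i - z (edge p i)) * H p = (\<Sum>i\<in>addable N p. H (add_cell p i))"
proof -
  have mono: "antimono p" using p by (simp add: bounded_partition_def)
  have le: "p (Suc j) \<le> p j" for j using mono by (simp add: antimono_iff_le_Suc)
  have fin: "finite (addable N p)" by (auto simp: addable_def)
  define L0 where "L0 = (\<Sum>i<N. x i - z0 (edge p i))"
  define L where "L = (\<Sum>i<N. x i - z (edge p i))"
  \<comment> \<open>\<open>z\<close> and \<open>z0\<close> differ only at \<open>k\<close> and
    \<open>k + 1\<close>, so the factor changes only through rows bearing these labels.\<close>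
  have "L0 - L = (\<Sum>i<N. (if edge p i = k + 1 then w else 0) + (if edge p i = k then - w else 0))"
    unfolding L0_def L_def sum_subtractf[symmetric]
    by (intro sum.cong) (use z in \<open>auto simp: algebra_simps\<close>)
  then have L: "L0 - L = (if \<exists>i<N. edge p i = k + 1 then w else 0) + (if \<exists>i<N. edge p i = k then - w else 0)"
    by (simp only: sum.distrib sum_edge_delta[OF mono])
  have IHp: "L0 * G p = (\<Sum>i\<in>addable N p. G (add_cell p i))"
    using IH[OF p] by (simp add: L0_def)
  have rhs: "(\<Sum>i\<in>addable N p. H (add_cell p i)) =
      L0 * G p + w * (\<Sum>i\<in>addable N p. tail_term k G (add_cell p i))"
    by (simp add: H_def sum.distrib sum_distrib_left IHp)
  have mono_add: "antimono (add_cell p i)" if "i \<in> addable N p" for i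
    using bounded_partition_add_cell[OF p that] by (simp add: bounded_partition_def)
  show ?thesis
  \<comment> \<open>The cases are which of the labels \<open>k\<close>, \<open>k + 1\<close> belong
    to rows: only \<open>k + 1\<close> (removable corner), only \<open>k\<close> (addable corner),
    or both or neither, where the factor does not change.\<close>
  proof (cases "\<exists>r. removable_at k p r")
    case True
    then obtain r where r: "removable_at k p r" by blast
    have pr: "p (Suc r) < p r" using r by (simp add: removable_at_def)
    have rN: "r < N" using removable_row_bound[OF p pr] .
    have LL: "L = L0 - w"
    proof -
      have "\<exists>i<N. edge p i = k + 1" using r rN by (auto simp: removable_at_def)
      then show ?thesis using L no_edge_below_removable[OF mono r] by simp
    qed
    define q where "q = del_cell p r"
    have q: "bounded_partition N q" unfolding q_def by (rule bounded_partition_del_cell[OF p pr])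
    have Hp: "H p = G p + w * G q" by (simp add: H_def tail_term_removable[OF mono r] q_def)
    \<comment> \<open>Deleting the corner lowers one row label from \<open>k + 1\<close> to
      \<open>k\<close>, so the factor of \<open>q\<close> under \<open>z0\<close> equals that of
      \<open>p\<close> under \<open>z\<close>.\<close>
    have "(\<Sum>i<N. x i - z0 (edge q i)) = L0 - w"
    proof -
      have "(\<Sum>i<N. x i - z0 (edge q i)) - L0 = (\<Sum>i<N. if i = r then z0 (k+1) - z0 k else 0)"
        unfolding L0_def sum_subtractf[symmetric]
        by (intro sum.cong) (use r pr in \<open>auto simp: q_def del_cell_def edge_def removable_at_def of_nat_diff intro!: arg_cong[of _ _ z0]\<close>)
      also have "\<dots> = z0 (k+1) - z0 k" using rN by simp
      finally have 1: "(\<Sum>i<N. x i - z0 (edge q i)) - L0 = z0 (k+1) - z0 k" .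
      then show ?thesis using z0 by simp
    qed
    then have q_eq: "(L0 - w) * G q = (\<Sum>i\<in>addable N q. G (add_cell q i))"
      using IH[OF q] by simp
    have add_r: "r \<in> addable N q" "add_cell q r = p"
    proof -
      have "p r \<le> p (r - 1)" using mono by (simp add: antimono_def)
      then show "r \<in> addable N q" using rN pr by (auto simp: q_def addable_def del_cell_def)
      show "add_cell q r = p" using pr by (auto simp: q_def add_cell_def del_cell_def)
    qed
    have sub: "addable N q - {r} \<subseteq> addable N p"
    proof
      fix i assume i: "i \<in> addable N q - {r}"
      have "q (i - 1) \<le> p (i - 1)" by (simp add: q_def del_cell_def)
      then show "i \<in> addable N p" using i by (auto simp: addable_def q_def del_cell_def)
    qed
    have t1: "tail_term k G (add_cell p i) = G (add_cell q i)" if i: "i \<in> addable N q - {r}" for i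
    proof -
      have "add_cell p i (Suc r) < p r"
        using i pr by (auto simp: add_cell_def addable_def q_def del_cell_def)
      then have "removable_at k (add_cell p i) r"
        using i r by (auto simp: removable_at_def edge_def add_cell_def)
      moreover have "del_cell (add_cell p i) r = add_cell q i"
        using i by (auto simp: q_def del_cell_def add_cell_def)
      ultimately show ?thesis using tail_term_removable[OF mono_add] sub i by auto
    qed
    \<comment> \<open>Two additions to \<open>p\<close> destroy the corner: lengthening row
      \<open>r\<close> itself, and filling the cell directly below the corner when row
      \<open>Suc r\<close> is just one cell shorter.\<close>
    have t0: "tail_term k G (add_cell p i) = 0" if i: "i \<in> addable N p - (addable N q - {r})" for i
    proof (rule tail_term_0, rule notI)
      fix s assume s: "removable_at k (add_cell p i) s"
      show False
      proof (cases "i = r")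
        case True
        then have "s \<noteq> r" using s r by (auto simp: removable_at_def edge_def add_cell_def)
        then have "edge p s = edge p r" using s r True by (auto simp: removable_at_def edge_def add_cell_def)
        then show False using edge_inj[OF mono] \<open>s \<noteq> r\<close> by auto
      next
        case False
        then have "i \<notin> addable N q" using i by auto
        then have i2: "i = Suc r" "p i = p r - 1"
          using i False le[of r] by (auto simp: addable_def q_def del_cell_def split: if_splits)
        have "edge (add_cell p i) s = edge (add_cell p i) r"
          using s r False by (auto simp: removable_at_def edge_def add_cell_def)
        then have "s = r" using edge_inj[OF mono_add] i by blast
        then show False using s i2 by (auto simp: removable_at_def add_cell_def)
      qed
    qed
    have "(\<Sum>i\<in>addable N p. tail_term k G (add_cell p i)) =
        (\<Sum>i\<in>addable N q - {r}. tail_term k G (add_cell p i))"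
      by (rule sum.mono_neutral_right) (use fin sub t0 in auto)
    also have "\<dots> = (\<Sum>i\<in>addable N q - {r}. G (add_cell q i))" using t1 by simp
    \<comment> \<open>In the Pieri rule for \<open>q\<close> the addition in row \<open>r\<close>
      restores \<open>p\<close>; that summand is split off.\<close>
    also have "\<dots> = (L0 - w) * G q - G p"
      using sum.remove[of "addable N q" r "\<lambda>i. G (add_cell q i)"] add_r q_eq
      by (simp add: addable_def)
    finally have "(\<Sum>i\<in>addable N p. tail_term k G (add_cell p i)) = (L0 - w) * G q - G p" .
    then show ?thesis unfolding rhs L_def[symmetric] LL Hp by (simp only:) (simp add: algebra_simps)
  next
    case False
    have Hp: "H p = G p" using tail_term_0 False by (simp add: H_def)
    \<comment> \<open>A corner of content \<open>k\<close> in \<open>add_cell p i\<close> can now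
      only be the new cell, whose deletion gives back \<open>p\<close>.\<close>
    have t: "tail_term k G (add_cell p i) = (if edge p i = k then G p else 0)"
      if i: "i \<in> addable N p" for i
    proof (cases "edge p i = k")
      case True
      then have "removable_at k (add_cell p i) i"
        using le[of i] by (auto simp: removable_at_def add_cell_def edge_def)
      moreover have "del_cell (add_cell p i) i = p" by (auto simp: del_cell_def add_cell_def)
      ultimately show ?thesis using tail_term_removable[OF mono_add[OF i]] True by simp
    next
      case f: False
      have "\<not> removable_at k (add_cell p i) s" for s
      proof
        assume s: "removable_at k (add_cell p i) s"
        then have "s \<noteq> i" using f by (auto simp: removable_at_def edge_def add_cell_def)
        then have "removable_at k p s" using s
          by (auto simp: removable_at_def edge_def add_cell_def split: if_splits)
        then show False using False by blast
      qed
      then show ?thesis using tail_term_0 f by simp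
    qed
    have s: "(\<Sum>i\<in>addable N p. tail_term k G (add_cell p i)) =
        (\<Sum>i\<in>addable N p. if edge p i = k then G p else 0)"
      using t by simp
    show ?thesis
    proof (cases "\<exists>i\<in>addable N p. edge p i = k")
      case True
      then obtain i where i: "i \<in> addable N p" "edge p i = k" by blast
      have "edge p l = k \<longleftrightarrow> l = i" for l using i(2) edge_inj[OF mono] by metis
      then have "(\<Sum>i\<in>addable N p. tail_term k G (add_cell p i)) = G p"
        unfolding s using i fin by simp
      moreover have "L = L0 + w"
      proof -
        have "\<exists>i<N. edge p i = k" using i by (auto simp: addable_def)
        then show ?thesis using L no_edge_above_addable[OF mono i] by simp
      qed
      ultimately show ?thesis unfolding rhs L_def[symmetric] Hp by (simp add: algebra_simps)
    next
      case nadd: False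
      then have "(\<Sum>i\<in>addable N p. tail_term k G (add_cell p i)) = 0"
        unfolding s by (intro sum.neutral) auto
      moreover have "(\<exists>i<N. edge p i = k + 1) \<longleftrightarrow> (\<exists>i<N. edge p i = k)"
      proof
        assume "\<exists>i<N. edge p i = k + 1"
        then obtain i where i: "i < N" "edge p i = k + 1" by blast
        then have "p (Suc i) = p i" using False le[of i] by (auto simp: removable_at_def)
        then have "edge p (Suc i) = k" using i by (auto simp: edge_def)
        \<comment> \<open>Without \<open>- int N < k\<close>, the row carrying label
          \<open>k\<close> could be the empty row \<open>N\<close>, outside the sums.\<close>
        moreover have "Suc i < N"
        proof (rule ccontr)
          assume "\<not> Suc i < N"
          then have "Suc i = N" using i by auto
          then have "p (Suc i) = 0" using p by (auto simp: bounded_partition_def)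
          then show False using \<open>edge p (Suc i) = k\<close> k \<open>Suc i = N\<close> by (auto simp: edge_def)
        qed
        ultimately show "\<exists>i<N. edge p i = k" by blast
      next
        assume "\<exists>i<N. edge p i = k"
        then obtain i where i: "i < N" "edge p i = k" by blast
        then have "i \<notin> addable N p" using nadd by blast
        then have "i \<noteq> 0" "p i = p (i - 1)"
          using i mono by (auto simp: addable_def antimono_def intro!: antisym)
        then have "edge p (i - 1) = k + 1" using i by (auto simp: edge_def)
        then show "\<exists>i<N. edge p i = k + 1" using i by (meson less_imp_diff_less)
      qed
      ultimately show ?thesis using L unfolding rhs L_def[symmetric] Hp by (auto simp: algebra_simps)
    qed
  qed
qed


section \<open>Corners, excited moves, and the recursive construction of the weights\<close>

lemma del_cell_diagram: "diagram (del_cell p i) = diagram p - {(i, p i - 1)}"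
  by (auto simp: diagram_def del_cell_def split: if_splits)

lemma finite_diagram: "bounded_partition N p \<Longrightarrow> finite (diagram p)"
proof -
  assume p: "bounded_partition N p"
  have "diagram p \<subseteq> (SIGMA i:{..<N}. {..<p i})"
  proof
    fix c assume "c \<in> diagram p"
    then obtain i j where c: "c = (i, j)" "j < p i" by (auto simp: diagram_def)
    then have "i < N" using p by (metis bounded_partition_def linorder_not_less not_less0)
    then show "c \<in> (SIGMA i:{..<N}. {..<p i})" using c by auto
  qed
  then show ?thesis by (rule finite_subset) auto
qed

lemma diagram_mono_closed:
  "antimono p \<Longrightarrow> (i, j) \<in> diagram p \<Longrightarrow> i' \<le> i \<Longrightarrow> j' \<le> j \<Longrightarrow> (i', j') \<in> diagram p"
  unfolding diagram_def antimono_def by (auto intro: le_less_trans less_le_trans)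

lemma nat_eq_lessI: "(\<And>i. i < (a::nat) \<longleftrightarrow> i < b) \<Longrightarrow> a = b"
  by (meson linorder_neqE_nat order_less_irrefl)

lemma conjugate_corner:
  assumes "partition p" "p (Suc r) < p r"
  shows "conjugate p (p r - 1) = Suc r"
proof (rule nat_eq_lessI)
  fix i
  have "p r \<le> p i" if "i \<le> r" using assms(1) that by (auto simp: partition_def antimono_def)
  moreover have "p i \<le> p (Suc r)" if "Suc r \<le> i"
    using assms(1) that by (auto simp: partition_def antimono_def)
  ultimately show "i < conjugate p (p r - 1) \<longleftrightarrow> i < Suc r"
    unfolding less_conjugate_iff[OF assms(1)] using assms(2) by (cases "i \<le> r") fastforce+
qed

lemma conjugate_del_cell:
  assumes "partition p" "partition (del_cell p r)" "p (Suc r) < p r"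
  shows "conjugate (del_cell p r) j = (if j = p r - 1 then r else conjugate p j)"
proof (rule nat_eq_lessI)
  fix i
  have 1: "p r \<le> p i" if "i \<le> r" using assms(1) that by (auto simp: partition_def antimono_def)
  have 2: "p i \<le> p (Suc r)" if "Suc r \<le> i"
    using assms(1) that by (auto simp: partition_def antimono_def)
  show "i < conjugate (del_cell p r) j \<longleftrightarrow> i < (if j = p r - 1 then r else conjugate p j)"
  proof (cases "j = p r - 1")
    case True
    then show ?thesis using 1 2 assms(3)
      unfolding less_conjugate_iff[OF assms(2)]
      by (cases i r rule: linorder_cases) (fastforce simp: del_cell_def)+
  next
    case False
    have "j < del_cell p r i \<longleftrightarrow> j < p i" using False by (auto simp: del_cell_def)
    then show ?thesis
      using False by (simp add: less_conjugate_iff[OF assms(2)] less_conjugate_iff[OF assms(1)])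
  qed
qed

lemma excited_mono:
  assumes "diagram p0 \<subseteq> diagram p" "D \<in> excited_diagrams p0 q"
  shows "D \<in> excited_diagrams p q"
  using assms(2)
proof induction
  case start
  show ?case by (rule excited_diagrams.start)
next
  case (move D i j)
  then have "active p D (i, j)" using assms(1) by (auto simp: active_def)
  then show ?case using move by (intro excited_diagrams.move)
qed

lemma excited_subset:
  assumes "diagram q \<subseteq> diagram p" "D \<in> excited_diagrams p q"
  shows "D \<subseteq> diagram p"
  using assms(2)
proof induction
  case (move D i j)
  then show ?case by (auto simp: active_def)
qed (rule assms(1))

lemma finite_excited:
  assumes "bounded_partition N p" "diagram q \<subseteq> diagram p"
  shows "finite (excited_diagrams p q)"
proof (rule finite_subset)
  show "excited_diagrams p q \<subseteq> Pow (diagram p)" using excited_subset[OF assms(2)] by blast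
  show "finite (Pow (diagram p))" using finite_diagram[OF assms(1)] by simp
qed

text \<open>The removable cell of \<open>q\<close> in row \<open>r\<close> first travels along its diagonal to the corner of \<open>p\<close>;
  afterwards all moves inside \<open>p0\<close> remain possible.\<close>

lemma excited_insert_corner:
  assumes p: "antimono p" and q: "antimono q" and r: "q (Suc r) < q r"
    and c: "(r + t, q r - 1 + t) \<in> diagram p"
    and c0: "diagram p0 = diagram p - {(r + t, q r - 1 + t)}"
    and q0: "diagram (del_cell q r) \<subseteq> diagram p0"
    and D: "D \<in> excited_diagrams p0 (del_cell q r)"
  shows "insert (r + t, q r - 1 + t) D \<in> excited_diagrams p q"
  using D
proof induction
  case start
  define E where "E s = insert (r + s, q r - 1 + s) (diagram (del_cell q r))" for s
  have out: "(i, j) \<notin> diagram q" if "i \<ge> r" "j \<ge> q r" for i j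
    using q that by (metis antimonoD case_prodD diagram_def le_trans linorder_not_less mem_Collect_eq)
  have out': "(i, j) \<notin> diagram q" if "i > r" "j \<ge> q r - 1" for i j
  proof -
    have "q i \<le> q (Suc r)" using q that by (auto simp: antimono_def)
    then show ?thesis using r that by (auto simp: diagram_def)
  qed
  have "E s \<in> excited_diagrams p q" if "s \<le> t" for s
    using that
  proof (induction s)
    case 0
    have "E 0 = diagram q" using r unfolding E_def del_cell_diagram by (auto simp: diagram_def)
    then show ?case by (simp add: excited_diagrams.start)
  next
    case (Suc s)
    let ?i = "r + s" and ?j = "q r - 1 + s"
    have *: "(i', j') \<in> diagram p" if "i' \<le> r + t" "j' \<le> q r - 1 + t" for i' j'
      using diagram_mono_closed[OF p c that] .
    have "{(Suc ?i, ?j), (?i, Suc ?j), (Suc ?i, Suc ?j)} \<inter> diagram q = {}"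
      using out[of ?i "Suc ?j"] out'[of "Suc ?i" ?j] out'[of "Suc ?i" "Suc ?j"] r by auto
    moreover have "{(Suc ?i, ?j), (?i, Suc ?j), (Suc ?i, Suc ?j)} \<subseteq> diagram p"
      using Suc.prems by (auto intro!: *)
    ultimately have "active p (E s) (?i, ?j)"
      unfolding active_def by (auto simp: E_def del_cell_diagram)
    then have "insert (Suc ?i, Suc ?j) (E s - {(?i, ?j)}) \<in> excited_diagrams p q"
      using Suc by (intro excited_diagrams.move) auto
    moreover have "(?i, ?j) \<notin> diagram (del_cell q r)"
    proof (cases "s = 0")
      case False
      then have "(?i, ?j) \<notin> diagram q" by (intro out') auto
      then show ?thesis by (simp add: del_cell_diagram)
    qed (simp add: del_cell_diagram)
    ultimately show ?case by (simp add: E_def)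
  qed
  from this[of t] show ?case by (simp add: E_def)
next
  case (move D i j)
  define c where "c = (r + t, q r - 1 + t)"
  note c0 = c0[folded c_def]
  \<comment> \<open>A move within \<open>p0\<close> involves only cells of \<open>p0\<close>, and
    \<open>c\<close> is not among them, so the move commutes with inserting
    \<open>c\<close>.\<close>
  have *: "active p (insert c D) (i, j)"
    using move.hyps(2) unfolding active_def c0 by blast
  have cD: "c \<noteq> (Suc i, Suc j)" "(i, j) \<in> D"
    using move.hyps(2) unfolding active_def c0 by auto
  have "(i, j) \<noteq> c"
    using excited_subset[OF q0 move.hyps(1)] cD c0 by auto
  then have "insert c (insert (Suc i, Suc j) (D - {(i, j)})) = insert (Suc i, Suc j) (insert c D - {(i, j)})"
    by auto
  then show ?case using excited_diagrams.move[OF move.IH[folded c_def] *] by (simp add: c_def)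
qed

lemma exists_corner:
  assumes "bounded_partition N p" "p i \<noteq> 0"
  obtains r where "r < N" "p (Suc r) < p r"
proof -
  have "\<exists>r. p (Suc r) < p r"
  proof (rule ccontr)
    assume "\<not> ?thesis"
    then have "\<And>l. p l \<le> p (Suc l)" by (auto simp: not_less)
    then have "p i \<le> p (max i N)" by (rule lift_Suc_mono_le) simp
    then show False using assms by (auto simp: bounded_partition_def)
  qed
  then show ?thesis using that removable_row_bound[OF assms(1)] by blast
qed

text \<open>Here \<open>x i\<close> and \<open>y j\<close> stay fixed while corners are removed from \<open>p\<close>, and \<open>z\<close> lists the labels of the
  boundary steps of \<open>p\<close>: \<open>x i\<close> for rows and \<open>- y j\<close> for columns. Removing a corner \<open>c\<close> of content \<open>k\<close>
  splits the excited diagrams of \<open>p/q\<close> into those avoiding \<open>c\<close> and those containing it; in the latter \<open>c\<close> is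
  the image of the removable cell of \<open>q\<close> on diagonal \<open>k\<close>.\<close>

lemma excited_weight_bounds:
  fixes x y :: "nat \<Rightarrow> real" and w :: "nat \<times> nat \<Rightarrow> real"
  assumes w: "\<And>i j. w (i, j) = x i + y j"
    and "bounded_partition N p" "\<And>c. c \<in> diagram p \<Longrightarrow> w c \<ge> 0"
    and "\<And>i. i < N \<Longrightarrow> z (edge p i) = x i"
    and "\<And>j. z (int j + 1 - int (conjugate p j)) = - y j"
  shows "\<exists>G. \<forall>q. bounded_partition N q \<longrightarrow>
    (\<Sum>i<N. x i - z (edge q i)) * G q = (\<Sum>i\<in>addable N q. G (add_cell q i)) \<and>
    (diagram q \<subseteq> diagram p \<longrightarrow> prod w (diagram q) \<le> G q \<and>
       G q \<le> (\<Sum>D\<in>excited_diagrams p q. prod w D)) \<and>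
    (\<not> diagram q \<subseteq> diagram p \<longrightarrow> G q = 0)"
  using assms(2-)
proof (induction "card (diagram p)" arbitrary: p z)
  case 0
  then have "diagram p = {}" using finite_diagram by auto
  then have p0: "p i = 0" for i unfolding diagram_def by (metis (mono_tags, lifting) Collect_empty_eq case_prodI neq0_conv)
  have empty: "diagram q = {} \<longleftrightarrow> (\<forall>i. q i = 0)" for q by (auto simp: diagram_def)
  \<comment> \<open>For the empty outer shape the Pieri factor vanishes at the empty partition
    because all row labels agree, and adding a cell always leaves the support of
    \<open>G\<close>.\<close>
  define G :: "(nat \<Rightarrow> nat) \<Rightarrow> real" where "G q = (if diagram q = {} then 1 else 0)" for q
  have "(\<Sum>i<N. x i - z (edge q i)) * G q = (\<Sum>i\<in>addable N q. G (add_cell q i))" for q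
  proof -
    have "G (add_cell q i) = 0" for i by (auto simp: G_def empty add_cell_def)
    moreover have "(\<Sum>i<N. x i - z (edge q i)) = 0" if "diagram q = {}"
    proof -
      have "edge q i = edge p i" for i using that p0 by (auto simp: empty edge_def)
      then show ?thesis using "0.prems"(3) by simp
    qed
    ultimately show ?thesis by (simp add: G_def)
  qed
  moreover have "G q \<le> (\<Sum>D\<in>excited_diagrams p q. prod w D)" if "diagram q \<subseteq> diagram p" for q
  proof -
    have q: "diagram q = {}" using that \<open>diagram p = {}\<close> by simp
    then have "excited_diagrams p q \<subseteq> {{}}"
      using excited_subset[OF that] \<open>diagram p = {}\<close> by auto
    moreover have "{} \<in> excited_diagrams p q" using excited_diagrams.start[of q p] q by simp
    ultimately have "excited_diagrams p q = {{}}" by auto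
    then show ?thesis using q by (simp add: G_def)
  qed
  ultimately show ?case using \<open>diagram p = {}\<close> by (intro exI[of _ G]) (auto simp: G_def)
next
  case (Suc n)
  note p = Suc.prems(1)
  have mono: "antimono p" using p by (simp add: bounded_partition_def)
  have "diagram p \<noteq> {}" using Suc.hyps(2) by auto
  then obtain i j where "j < p i" unfolding diagram_def by auto
  then have "p i \<noteq> 0" by simp
  then obtain r where r: "r < N" "p (Suc r) < p r" using exists_corner[OF p] by blast
  define k where "k = edge p r - 1"
  define c where "c = (r, p r - 1)"
  define p' where "p' = del_cell p r"
  have p': "bounded_partition N p'" unfolding p'_def by (rule bounded_partition_del_cell[OF p r(2)])
  note par = bounded_partition_imp_partition[OF p] and par' = bounded_partition_imp_partition[OF p', unfolded p'_def]
  have c: "c \<in> diagram p" using r by (auto simp: c_def diagram_def)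
  have dp': "diagram p' = diagram p - {c}" by (simp add: p'_def c_def del_cell_diagram)
  define z' where "z' v = (if v = k then z (k + 1) else if v = k + 1 then z k else z v)" for v
  have zk1: "z (k + 1) = x r" using Suc.prems(3)[OF r(1)] by (simp add: k_def)
  have zk: "z k = - y (p r - 1)"
  proof -
    have "int (p r - 1) + 1 - int (conjugate p (p r - 1)) = k"
      unfolding conjugate_corner[OF par r(2)] using r by (simp add: k_def edge_def of_nat_diff)
    then show ?thesis using Suc.prems(4)[of "p r - 1"] by simp
  qed
  \<comment> \<open>Row value minus column value at the corner: this is the \<open>w\<close> that
    \<open>pieri_step\<close> asks for.\<close>
  have wc: "w c = z (k + 1) - z k" by (simp add: c_def w zk zk1)
  have rem: "removable_at k p r" using r by (simp add: removable_at_def k_def)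
  have "\<exists>G. \<forall>q. bounded_partition N q \<longrightarrow>
    (\<Sum>i<N. x i - z' (edge q i)) * G q = (\<Sum>i\<in>addable N q. G (add_cell q i)) \<and>
    (diagram q \<subseteq> diagram p' \<longrightarrow> prod w (diagram q) \<le> G q \<and>
       G q \<le> (\<Sum>D\<in>excited_diagrams p' q. prod w D)) \<and>
    (\<not> diagram q \<subseteq> diagram p' \<longrightarrow> G q = 0)"
  proof (rule Suc.hyps(1))
    show "n = card (diagram p')" using Suc.hyps(2) c finite_diagram[OF p] by (simp add: dp')
    show "bounded_partition N p'" by (rule p')
    show "w d \<ge> 0" if "d \<in> diagram p'" for d using that Suc.prems(2) dp' by auto
    show "z' (edge p' i) = x i" if "i < N" for i
    proof (cases "i = r")
      case True
      then have "edge p' i = k" using r by (simp add: edge_def p'_def del_cell_def k_def of_nat_diff)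
      then show ?thesis by (simp add: z'_def zk1 True)
    next
      case False
      then have "edge p' i = edge p i" by (simp add: edge_def p'_def del_cell_def)
      moreover have "edge p i \<noteq> k + 1" using False edge_inj[OF mono, of i r] by (auto simp: k_def)
      ultimately show ?thesis using no_edge_below_removable[OF mono rem] Suc.prems(3)[OF that]
        by (simp add: z'_def)
    qed
    show "z' (int j + 1 - int (conjugate p' j)) = - y j" for j
    proof (cases "j = p r - 1")
      case True
      then have "int j + 1 - int (conjugate p' j) = k + 1"
        using r unfolding p'_def conjugate_del_cell[OF par par' r(2)]
        by (simp add: k_def edge_def of_nat_diff)
      then show ?thesis using zk True by (simp add: z'_def)
    next
      case False
      have cj: "conjugate p' j = conjugate p j"
        using False by (simp add: p'_def conjugate_del_cell[OF par par' r(2)])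
      \<comment> \<open>Columns strictly left of the corner have labels below \<open>k\<close>,
        those strictly right of it labels above \<open>k + 1\<close>.\<close>
      have "r < conjugate p j \<longleftrightarrow> j < p r" by (rule less_conjugate_iff[OF par])
      then have "int j + 1 - int (conjugate p j) < k \<or> int j + 1 - int (conjugate p j) > k + 1"
        using False by (auto simp: k_def edge_def)
      then have "z' (int j + 1 - int (conjugate p j)) = z (int j + 1 - int (conjugate p j))"
        by (auto simp: z'_def)
      then show ?thesis using Suc.prems(4)[of j] by (simp add: cj)
    qed
  qed
  then obtain G where pieri: "\<And>q. bounded_partition N q \<Longrightarrow>
      (\<Sum>i<N. x i - z' (edge q i)) * G q = (\<Sum>i\<in>addable N q. G (add_cell q i))"
    and low: "\<And>q. bounded_partition N q \<Longrightarrow> diagram q \<subseteq> diagram p' \<Longrightarrow> prod w (diagram q) \<le> G q"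
    and up: "\<And>q. bounded_partition N q \<Longrightarrow> diagram q \<subseteq> diagram p' \<Longrightarrow>
       G q \<le> (\<Sum>D\<in>excited_diagrams p' q. prod w D)"
    and zero: "\<And>q. bounded_partition N q \<Longrightarrow> \<not> diagram q \<subseteq> diagram p' \<Longrightarrow> G q = 0"
    by blast
  define H where "H q = G q + w c * tail_term k G q" for q
  have H_pieri: "(\<Sum>i<N. x i - z (edge q i)) * H q = (\<Sum>i\<in>addable N q. H (add_cell q i))"
    if "bounded_partition N q" for q
  proof -
    have z1: "z v - z' v = (if v = k + 1 then w c else if v = k then - w c else 0)" for v
      by (auto simp: z'_def wc)
    have z2: "z' (k + 1) - z' k = - w c" by (simp add: z'_def wc)
    have z3: "- int N < k" using r by (simp add: k_def edge_def)
    show ?thesis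
      using pieri_step[where ?z0.0 = z' and G = G and z = z and H = H, OF pieri z1 z2 z3 that H_def] by simp
  qed
  note fin_E = finite_excited
  have nonneg: "prod w D \<ge> 0" if "D \<subseteq> diagram p" for D
    using that Suc.prems(2) by (intro prod_nonneg) auto
  have wc0: "w c \<ge> 0" using Suc.prems(2) c by blast
  have main: "prod w (diagram q) \<le> H q \<and> H q \<le> (\<Sum>D\<in>excited_diagrams p q. prod w D)"
    if q: "bounded_partition N q" and sub: "diagram q \<subseteq> diagram p" for q
  proof -
    have monoq: "antimono q" using q by (simp add: bounded_partition_def)
    have le: "q i \<le> p i" for i
    proof (rule ccontr)
      assume "\<not> q i \<le> p i"
      then have "(i, p i) \<in> diagram q" by (simp add: diagram_def)
      then have "(i, p i) \<in> diagram p" using sub by blast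
      then show False by (simp add: diagram_def)
    qed
    have E0: "excited_diagrams p' q \<subseteq> excited_diagrams p q"
      using excited_mono[of p' p] dp' by blast
    show ?thesis
    proof (cases "\<exists>s. removable_at k q s")
      case True
      then obtain s where s: "removable_at k q s" by blast
      define q' where "q' = del_cell q s"
      have qs: "q (Suc s) < q s" using s by (simp add: removable_at_def)
      have q': "bounded_partition N q'" unfolding q'_def by (rule bounded_partition_del_cell[OF q qs])
      have es: "edge q s = edge p r" using s by (simp add: removable_at_def k_def)
      \<comment> \<open>The removable cell of \<open>q\<close> shares its diagonal with
        \<open>c\<close> and lies in \<open>p\<close>, so it is weakly up-left of \<open>c\<close>;
        \<open>t\<close> below is the distance along the diagonal.\<close>
      have "s \<le> r"
      proof (rule ccontr)
        assume "\<not> s \<le> r"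
        then have "p s \<le> p (Suc r)" using mono by (auto simp: antimono_def)
        then have "q s \<le> p (Suc r)" using le[of s] by simp
        then show False using es r \<open>\<not> s \<le> r\<close> by (auto simp: edge_def)
      qed
      then obtain t where t: "r = s + t" using le_Suc_ex by blast
      have pr: "p r = q s + t" using es t by (simp add: edge_def)
      have ct: "c = (s + t, q s - 1 + t)" using pr t qs by (simp add: c_def)
      have q'0: "diagram q' \<subseteq> diagram p'"
      proof -
        have "c \<notin> diagram q'"
        proof (cases "t = 0")
          case True
          then show ?thesis using ct by (simp add: q'_def del_cell_diagram)
        next
          case False
          then have "q r \<le> q (Suc s)" using monoq t by (auto simp: antimono_def)
          then have "c \<notin> diagram q" using qs pr False by (auto simp: c_def diagram_def)
          then show ?thesis by (simp add: q'_def del_cell_diagram)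
        qed
        then show ?thesis using sub by (auto simp: dp' q'_def del_cell_diagram)
      qed
      have H: "H q = G q + w c * G q'" by (simp add: H_def tail_term_removable[OF monoq s] q'_def)
      have Ein: "insert c D \<in> excited_diagrams p q" if "D \<in> excited_diagrams p' q'" for D
        by (rule excited_insert_corner[OF mono monoq qs, of t p' D, folded ct q'_def, OF c dp' q'0 that])
      \<comment> \<open>If \<open>q\<close> is not inside \<open>p'\<close>, then
        \<open>G q = 0\<close>, yet \<open>excited_diagrams p' q\<close> still contains
        \<open>diagram q\<close> itself. The family must then be taken empty.\<close>
      define A where "A = (if diagram q \<subseteq> diagram p' then excited_diagrams p' q else {})"
      have A: "G q \<le> (\<Sum>D\<in>A. prod w D)" using up[OF q] zero[OF q] by (auto simp: A_def)
      have Asub: "D \<subseteq> diagram p'" if "D \<in> A" for D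
        using that excited_subset unfolding A_def by (metis empty_iff)
      have Bsub: "D \<subseteq> diagram p'" if "D \<in> excited_diagrams p' q'" for D
        using that excited_subset[OF q'0] by blast
      have cp': "c \<notin> diagram p'" by (simp add: dp')
      have finp': "finite (diagram p')" by (rule finite_diagram[OF p'])
      have "w c * G q' \<le> w c * (\<Sum>D\<in>excited_diagrams p' q'. prod w D)"
        using up[OF q' q'0] wc0 by (rule mult_left_mono)
      also have "\<dots> = (\<Sum>D\<in>excited_diagrams p' q'. prod w (insert c D))"
        unfolding sum_distrib_left
      proof (rule sum.cong[OF refl])
        fix D assume "D \<in> excited_diagrams p' q'"
        then have "D \<subseteq> diagram p'" by (rule Bsub)
        then show "w c * prod w D = prod w (insert c D)"
          using cp' finite_subset[OF _ finp', of D] by (subst prod.insert) auto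
      qed
      also have "\<dots> = (\<Sum>D\<in>insert c ` excited_diagrams p' q'. prod w D)"
      proof -
        have "inj_on (insert c) (excited_diagrams p' q')"
        proof (rule inj_onI)
          fix D E assume "D \<in> excited_diagrams p' q'" "E \<in> excited_diagrams p' q'" "insert c D = insert c E"
          moreover from this have "c \<notin> D" "c \<notin> E" using Bsub cp' by blast+
          ultimately show "D = E" by (simp add: insert_ident)
        qed
        then show ?thesis by (simp add: sum.reindex)
      qed
      finally have "H q \<le> (\<Sum>D\<in>A. prod w D) + (\<Sum>D\<in>insert c ` excited_diagrams p' q'. prod w D)"
        using A H by simp
      \<comment> \<open>Membership of \<open>c\<close> separates the two families. Since weights
        inside \<open>p\<close> are nonnegative, inclusion in the excited diagrams of
        \<open>p\<close>, \<open>q\<close> is enough afterwards.\<close>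
      also have "\<dots> = (\<Sum>D\<in>A \<union> insert c ` excited_diagrams p' q'. prod w D)"
      proof (rule sum.union_disjoint[symmetric])
        show "finite A" using fin_E[OF p'] by (simp add: A_def)
        show "finite (insert c ` excited_diagrams p' q')" using fin_E[OF p' q'0] by simp
        show "A \<inter> insert c ` excited_diagrams p' q' = {}" using Asub cp' by blast
      qed
      also have "\<dots> \<le> (\<Sum>D\<in>excited_diagrams p q. prod w D)"
      proof (rule sum_mono2[OF fin_E[OF p sub]])
        show "A \<union> insert c ` excited_diagrams p' q' \<subseteq> excited_diagrams p q"
          using E0 Ein by (auto simp: A_def split: if_splits)
        show "0 \<le> prod w D" if "D \<in> excited_diagrams p q - (A \<union> insert c ` excited_diagrams p' q')" for D
          using that excited_subset[OF sub] by (intro nonneg) auto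
      qed
      finally have upper: "H q \<le> (\<Sum>D\<in>excited_diagrams p q. prod w D)" .
      have g0: "G q \<ge> 0" 
      proof (cases "diagram q \<subseteq> diagram p'")
        case True
        then show ?thesis using low[OF q True] nonneg[OF sub] by simp
      qed (use zero[OF q] in simp)
      have g0': "G q' \<ge> 0"
      proof -
        have "diagram q' \<subseteq> diagram p" using q'0 dp' by blast
        then show ?thesis using order_trans[OF nonneg low[OF q' q'0]] by blast
      qed
      \<comment> \<open>Inside \<open>p'\<close> the tail term only adds something nonnegative.
        Otherwise \<open>c\<close> lies in \<open>q\<close>, is its removable cell, and the tail
        term alone supplies the product.\<close>
      have lower: "prod w (diagram q) \<le> H q"
      proof (cases "diagram q \<subseteq> diagram p'")
        case True
        then show ?thesis using low[OF q True] H mult_nonneg_nonneg[OF wc0 g0'] by linarith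
      next
        case False
        then have cq: "c \<in> diagram q" using sub by (auto simp: dp')
        have "t = 0"
        proof (rule ccontr)
          assume "t \<noteq> 0"
          then have "q r \<le> q (Suc s)" using monoq t by (auto simp: antimono_def)
          then show False using cq qs pr \<open>t \<noteq> 0\<close> by (auto simp: c_def diagram_def)
        qed
        then have "diagram q = insert c (diagram q')" using ct cq
          by (auto simp: q'_def del_cell_diagram)
        moreover have "c \<notin> diagram q'" using cp' q'0 by blast
        ultimately have "prod w (diagram q) = w c * prod w (diagram q')"
          using finite_diagram[OF q'] by simp
        also have "\<dots> \<le> w c * G q'" using low[OF q' q'0] wc0 by (rule mult_left_mono)
        finally show ?thesis using H g0 by simp
      qed
      show ?thesis using lower upper by blast
    next
      case False
      then have H: "H q = G q" using tail_term_0 by (simp add: H_def)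
      \<comment> \<open>If \<open>c\<close> were in \<open>q\<close>, it would be a removable corner
        of \<open>q\<close> of content \<open>k\<close>.\<close>
      have "c \<notin> diagram q"
      proof
        assume "c \<in> diagram q"
        then have "q r = p r" using le[of r] by (auto simp: c_def diagram_def)
        then have "removable_at k q r" using r le[of "Suc r"] by (auto simp: removable_at_def k_def edge_def)
        then show False using False by blast
      qed
      then have sub': "diagram q \<subseteq> diagram p'" using sub by (auto simp: dp')
      have "(\<Sum>D\<in>excited_diagrams p' q. prod w D) \<le> (\<Sum>D\<in>excited_diagrams p q. prod w D)"
        using fin_E[OF p sub] E0 by (rule sum_mono2) (use excited_subset[OF sub] in \<open>auto intro: nonneg\<close>)
      then show ?thesis using low[OF q sub'] up[OF q sub'] H by auto
    qed
  qed
  have H0: "H q = 0" if q: "bounded_partition N q" and nsub: "\<not> diagram q \<subseteq> diagram p" for q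
  proof -
    have monoq: "antimono q" using q by (simp add: bounded_partition_def)
    have G0: "G q = 0" using zero[OF q] nsub dp' by blast
    have "tail_term k G q = 0"
    proof (cases "\<exists>s. removable_at k q s")
      case True
      then obtain s where s: "removable_at k q s" by blast
      have qs: "q (Suc s) < q s" using s by (simp add: removable_at_def)
      have q': "bounded_partition N (del_cell q s)" by (rule bounded_partition_del_cell[OF q qs])
      have es: "edge q s = edge p r" using s by (simp add: removable_at_def k_def)
      \<comment> \<open>Otherwise only the deleted cell of \<open>q\<close> could lie outside
        \<open>p\<close>. On the diagonal of \<open>c\<close> it is either weakly up-left of
        \<open>c\<close>, hence in \<open>p\<close>, or strictly down-right, where the cell above it
        already leaves \<open>p\<close>.\<close>
      have "\<not> diagram (del_cell q s) \<subseteq> diagram p'"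
      proof
        assume sub: "diagram (del_cell q s) \<subseteq> diagram p'"
        have u: "(s, q s - 1) \<notin> diagram p"
          using sub nsub by (auto simp: del_cell_diagram dp')
        show False
        proof (cases "s \<le> r")
          case True
          then have "q s - 1 \<le> p r - 1" using es by (auto simp: edge_def)
          then show False using diagram_mono_closed[OF mono c[unfolded c_def] True] u by blast
        next
          case False
          have "q s \<le> q (s - 1)" using monoq by (auto simp: antimono_def)
          then have "(s - 1, q s - 1) \<in> diagram (del_cell q s)"
            using False qs by (auto simp: diagram_def del_cell_def)
          then have "(s - 1, q s - 1) \<in> diagram p" using sub by (auto simp: dp')
          then have "(r, q s - 1) \<in> diagram p"
            by (rule diagram_mono_closed[OF mono]) (use False in auto)
          then show False using es False qs by (auto simp: diagram_def edge_def)
        qed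
      qed
      then show ?thesis using zero[OF q'] by (simp add: tail_term_removable[OF monoq s])
    qed (use tail_term_0 in blast)
    then show ?thesis using G0 by (simp add: H_def)
  qed
  show ?case using H_pieri main H0 by (intro exI[of _ H]) blast
qed

section \<open>The hook length bounds\<close>

lemma skew_cells_iff: "(i, j) \<in> skew_cells p q \<longleftrightarrow> q i \<le> j \<and> j < p i"
  by (auto simp: skew_cells_def diagram_def)

lemma diagram_subset_iff: "diagram q \<subseteq> diagram p \<longleftrightarrow> (\<forall>i. q i \<le> p i)"
proof
  assume "diagram q \<subseteq> diagram p"
  then have "(i, p i) \<notin> diagram q" for i by (auto simp: diagram_def)
  then show "\<forall>i. q i \<le> p i" by (auto simp: diagram_def not_less)
qed (auto simp: diagram_def intro: less_le_trans)

lemma finite_skew_cells: "bounded_partition N p \<Longrightarrow> finite (skew_cells p q)"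
  by (simp add: skew_cells_def finite_diagram)

lemma SYT_ge_1: "T \<in> SYT p q \<Longrightarrow> c \<in> skew_cells p q \<Longrightarrow> T c \<ge> 1"
  unfolding SYT_def by (auto dest!: bij_betwE)

lemma finite_SYT: "bounded_partition N p \<Longrightarrow> finite (SYT p q)"
proof -
  assume p: "bounded_partition N p"
  have "SYT p q \<subseteq> (skew_cells p q \<rightarrow>\<^sub>E {1..card (skew_cells p q)})"
  proof
    fix T assume "T \<in> SYT p q"
    then have "bij_betw T (skew_cells p q) {1..card (skew_cells p q)}" "T \<in> extensional (skew_cells p q)"
      by (auto simp: SYT_def)
    then show "T \<in> skew_cells p q \<rightarrow>\<^sub>E {1..card (skew_cells p q)}"
      unfolding PiE_iff using bij_betwE by blast
  qed
  then show ?thesis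
    by (rule finite_subset) (intro finite_PiE finite_skew_cells[OF p] finite_atLeastAtMost)
qed

lemma skew_cells_add_cell: "skew_cells p (add_cell q i) = skew_cells p q - {(i, q i)}"
  by (auto simp: skew_cells_def diagram_def add_cell_def split: if_splits)

text \<open>A cell of the skew shape to the left of the entry 1 or above it would carry an entry
  less than 1, so that cell can be added to \<open>q\<close>.\<close>

lemma SYT_entry_1:
  assumes p: "bounded_partition N p" and q: "bounded_partition N q" and T: "T \<in> SYT p q" and ne: "skew_cells p q \<noteq> {}"
  shows "\<exists>i\<in>addable N q. q i < p i \<and> T (i, q i) = 1"
proof -
  have bij: "bij_betw T (skew_cells p q) {1..card (skew_cells p q)}"
    using T by (simp add: SYT_def)
  have "card (skew_cells p q) \<ge> 1"
    using ne finite_skew_cells[OF p] by (simp add: Suc_leI card_gt_0_iff)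
  then have "1 \<in> T ` skew_cells p q" using bij by (auto simp: bij_betw_def)
  then obtain i j where c: "(i, j) \<in> skew_cells p q" "T (i, j) = 1" by auto
  have row: "T (i, j) < T (i, j')" if "(i, j) \<in> skew_cells p q" "(i, j') \<in> skew_cells p q" "j < j'" for i j j'
    using T that unfolding SYT_def by blast
  have col: "T (i, j) < T (i', j)" if "(i, j) \<in> skew_cells p q" "(i', j) \<in> skew_cells p q" "i < i'" for i i' j
    using T that unfolding SYT_def by blast
  have j: "j = q i"
  proof (rule ccontr)
    assume "j \<noteq> q i"
    then have *: "(i, q i) \<in> skew_cells p q" "q i < j" using c by (auto simp: skew_cells_iff)
    show False using row[OF *(1) c(1) *(2)] SYT_ge_1[OF T *(1)] c(2) by simp
  qed
  have pi: "q i < p i" using c j by (simp add: skew_cells_iff)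
  have "q i < q (i - 1)" if "i \<noteq> 0"
  proof (rule ccontr)
    assume a: "\<not> q i < q (i - 1)"
    have "p i \<le> p (i - 1)" using p by (simp add: bounded_partition_def antimono_def)
    then have *: "(i - 1, j) \<in> skew_cells p q" using a j pi by (auto simp: skew_cells_iff)
    show False using col[OF *(1) c(1)] that SYT_ge_1[OF T *(1)] c(2) by simp
  qed
  moreover have "i < N" using p pi by (metis bounded_partition_def linorder_not_less not_less0)
  ultimately show ?thesis using pi c(2) j by (auto simp: addable_def)
qed

text \<open>Erasing the entry 1 and lowering all others by one (\<open>f\<close>) is inverted by
  raising all entries and putting 1 into the free cell (\<open>g\<close>).\<close>

lemma card_SYT_entry_1:
  assumes p: "bounded_partition N p" and q: "bounded_partition N q" and i: "i \<in> addable N q" "q i < p i"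
  shows "card {T \<in> SYT p q. T (i, q i) = 1} = num_SYT p (add_cell q i)"
proof -
  define S where "S = skew_cells p q"
  define u where "u = (i, q i)"
  have finS: "finite S" unfolding S_def by (rule finite_skew_cells[OF p])
  have u: "u \<in> S" using i by (simp add: S_def u_def skew_cells_iff)
  have S': "skew_cells p (add_cell q i) = S - {u}" by (simp add: skew_cells_add_cell S_def u_def)
  have card: "card S = Suc (card (S - {u}))" using card_Suc_Diff1[OF finS u] by simp
  have no_left: "(i, j) \<notin> S" if "j < q i" for j using that by (simp add: S_def skew_cells_iff)
  have no_up: "(l, q i) \<notin> S" if "l < i" for l
  proof -
    have "q i < q (i - 1)" using i(1) that by (auto simp: addable_def)
    also have "q (i - 1) \<le> q l" using q that by (auto simp: bounded_partition_def antimono_def)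
    finally show ?thesis by (simp add: S_def skew_cells_iff)
  qed
  define f where "f = (\<lambda>T::nat \<times> nat \<Rightarrow> nat. \<lambda>c\<in>S - {u}. T c - 1)"
  define g where "g = (\<lambda>T::nat \<times> nat \<Rightarrow> nat. \<lambda>c\<in>S. if c = u then 1 else T c + 1)"
  have SYT: "T \<in> SYT p q \<longleftrightarrow> T \<in> extensional S \<and> bij_betw T S {1..card S} \<and>
     (\<forall>i j j'. (i, j) \<in> S \<and> (i, j') \<in> S \<and> j < j' \<longrightarrow> T (i, j) < T (i, j')) \<and>
     (\<forall>i i' j. (i, j) \<in> S \<and> (i', j) \<in> S \<and> i < i' \<longrightarrow> T (i, j) < T (i', j))" for T
    by (simp add: SYT_def S_def)
  have SYT': "T \<in> SYT p (add_cell q i) \<longleftrightarrow>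
     T \<in> extensional (S - {u}) \<and> bij_betw T (S - {u}) {1..card (S - {u})} \<and>
     (\<forall>i j j'. (i, j) \<in> S - {u} \<and> (i, j') \<in> S - {u} \<and> j < j' \<longrightarrow> T (i, j) < T (i, j')) \<and>
     (\<forall>i i' j. (i, j) \<in> S - {u} \<and> (i', j) \<in> S - {u} \<and> i < i' \<longrightarrow> T (i, j) < T (i', j))" for T
    by (simp add: SYT_def S')
  have "bij_betw f {T \<in> SYT p q. T u = 1} (SYT p (add_cell q i))"
  proof (rule bij_betw_byWitness[where f' = g])
    show "\<forall>T\<in>{T \<in> SYT p q. T u = 1}. g (f T) = T"
    proof
      fix T assume T: "T \<in> {T \<in> SYT p q. T u = 1}"
      show "g (f T) = T"
      proof
        fix c
        have "T c \<ge> 1" if "c \<in> S" using SYT_ge_1[of T p q c] T that by (simp add: S_def)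
        moreover have "T c = undefined" if "c \<notin> S"
          using T that unfolding SYT extensional_def by blast
        ultimately show "g (f T) c = T c"
          using T u by (auto simp: f_def g_def)
      qed
    qed
    show "\<forall>T\<in>SYT p (add_cell q i). f (g T) = T"
    proof
      fix T assume "T \<in> SYT p (add_cell q i)"
      then have "T c = undefined" if "c \<notin> S - {u}" for c
        using that unfolding SYT' extensional_def by blast
      then show "f (g T) = T" by (auto simp: f_def g_def fun_eq_iff)
    qed
    show "f ` {T \<in> SYT p q. T u = 1} \<subseteq> SYT p (add_cell q i)"
    proof
      fix T' assume "T' \<in> f ` {T \<in> SYT p q. T u = 1}"
      then obtain T where T: "T \<in> SYT p q" "T u = 1" "T' = f T" by auto
      have ge: "T c \<ge> 1" if "c \<in> S" for c using SYT_ge_1[of T p q c] T that by (simp add: S_def)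
      have inj: "inj_on T S" and im: "T ` S = {1..card S}" using T(1) by (auto simp: SYT bij_betw_def)
      have gt: "T c > 1" if "c \<in> S - {u}" for c
      proof -
        have "T c \<noteq> T u" using inj that u by (auto dest: inj_onD)
        then show ?thesis using ge[of c] that T(2) by auto
      qed
      have "inj_on T' (S - {u})"
      proof (rule inj_onI)
        fix c d assume cd: "c \<in> S - {u}" "d \<in> S - {u}" "T' c = T' d"
        then have "T c = T d" using ge[of c] ge[of d] by (auto simp: T(3) f_def)
        then show "c = d" using inj cd by (auto dest: inj_onD)
      qed
      moreover have "T' ` (S - {u}) = {1..card (S - {u})}"
      proof (rule card_subset_eq)
        show "T' ` (S - {u}) \<subseteq> {1..card (S - {u})}"
        proof
          fix v assume "v \<in> T' ` (S - {u})"
          then obtain c where c: "c \<in> S - {u}" "v = T c - 1" by (auto simp: T(3) f_def)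
          moreover have "T c \<le> card S" using im c by auto
          ultimately show "v \<in> {1..card (S - {u})}" using gt[of c] card by auto
        qed
        show "card (T' ` (S - {u})) = card {1..card (S - {u})}"
          using card_image[OF calculation] by simp
      qed simp
      ultimately have "bij_betw T' (S - {u}) {1..card (S - {u})}" by (simp add: bij_betw_def)
      moreover have "T' \<in> extensional (S - {u})" by (simp add: T(3) f_def)
      moreover have "T' c < T' d" if "T c < T d" "c \<in> S - {u}" "d \<in> S - {u}" for c d
        using that gt[of c] by (auto simp: T(3) f_def)
      ultimately show "T' \<in> SYT p (add_cell q i)" using T(1) unfolding SYT SYT' by simp
    qed
    show "g ` SYT p (add_cell q i) \<subseteq> {T \<in> SYT p q. T u = 1}"
    proof
      fix T assume "T \<in> g ` SYT p (add_cell q i)"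
      then obtain T' where T': "T' \<in> SYT p (add_cell q i)" "T = g T'" by auto
      have ge: "T' c \<ge> 1" if "c \<in> S - {u}" for c
        using SYT_ge_1[OF T'(1)] that by (simp add: S')
      have inj: "inj_on T' (S - {u})" and im: "T' ` (S - {u}) = {1..card (S - {u})}"
        using T'(1) by (auto simp: SYT' bij_betw_def)
      have Tu: "T u = 1" using u by (simp add: T'(2) g_def)
      have Tc: "T c = T' c + 1" if "c \<in> S - {u}" for c using that by (simp add: T'(2) g_def)
      have ne1: "T c \<noteq> 1" if "c \<in> S - {u}" for c using Tc[OF that] ge[OF that] by simp
      have "inj_on T S"
      proof (rule inj_onI)
        fix c d assume cd: "c \<in> S" "d \<in> S" "T c = T d"
        show "c = d"
        proof (cases "c = u \<or> d = u")
          case True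
          then show ?thesis using cd Tu ne1 by (metis DiffI singletonD)
        next
          case False
          then have "T' c = T' d" using cd Tc[of c] Tc[of d] by simp
          then show ?thesis using cd False inj by (auto dest: inj_onD)
        qed
      qed
      moreover have "T ` S = {1..card S}"
      proof (rule card_subset_eq)
        show "T ` S \<subseteq> {1..card S}"
        proof
          fix v assume "v \<in> T ` S"
          then obtain c where c: "c \<in> S" "v = T c" by auto
          show "v \<in> {1..card S}"
          proof (cases "c = u")
            case False
            then have "T' c \<in> {1..card (S - {u})}" using im c by blast
            then show ?thesis using Tc[of c] c False card by auto
          qed (use c Tu card in auto)
        qed
        show "card (T ` S) = card {1..card S}" using card_image[OF calculation] by simp
      qed simp
      ultimately have 1: "bij_betw T S {1..card S}" by (simp add: bij_betw_def)
      have 2: "T \<in> extensional S" by (simp add: T'(2) g_def)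
      \<comment> \<open>Only \<open>d\<close> must differ from \<open>u\<close>: the entry at
        \<open>u\<close> is the smallest, and the shape has no cell left of \<open>u\<close> in its
        row or above \<open>u\<close> in its column.\<close>
      have 3: "T c < T d" if "c \<in> S" "d \<in> S" "d \<noteq> u" "c \<noteq> u \<Longrightarrow> T' c < T' d" for c d
        using that Tu Tc[of c] Tc[of d] ge[of d] by (cases "c = u") auto
      have "T (l, j) < T (l, j')" if "(l, j) \<in> S" "(l, j') \<in> S" "j < j'" for l j j'
      proof (rule 3[OF that(1,2)])
        show "(l, j') \<noteq> u" using no_left[of j] that by (auto simp: u_def)
        then show "T' (l, j) < T' (l, j')" if "(l, j) \<noteq> u"
          using T'(1) that \<open>(l, j) \<in> S\<close> \<open>(l, j') \<in> S\<close> \<open>j < j'\<close> unfolding SYT' by blast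
      qed
      moreover have "T (l, j) < T (l', j)" if "(l, j) \<in> S" "(l', j) \<in> S" "l < l'" for l l' j
      proof (rule 3[OF that(1,2)])
        show "(l', j) \<noteq> u" using no_up[of l] that by (auto simp: u_def)
        then show "T' (l, j) < T' (l', j)" if "(l, j) \<noteq> u"
          using T'(1) that \<open>(l, j) \<in> S\<close> \<open>(l', j) \<in> S\<close> \<open>l < l'\<close> unfolding SYT' by blast
      qed
      ultimately show "T \<in> {T \<in> SYT p q. T u = 1}" using 1 2 Tu unfolding SYT by auto
    qed
  qed
  then show ?thesis unfolding num_SYT_def u_def by (rule bij_betw_same_card)
qed

lemma num_SYT_recursion:
  assumes p: "bounded_partition N p" and q: "bounded_partition N q" and ne: "skew_cells p q \<noteq> {}"
  shows "num_SYT p q = (\<Sum>i\<in>{i \<in> addable N q. q i < p i}. num_SYT p (add_cell q i))"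
proof -
  let ?I = "{i \<in> addable N q. q i < p i}"
  let ?A = "\<lambda>i. {T \<in> SYT p q. T (i, q i) = 1}"
  have "SYT p q = (\<Union>i\<in>?I. ?A i)" using SYT_entry_1[OF p q _ ne] by blast
  moreover have "card (\<Union>i\<in>?I. ?A i) = (\<Sum>i\<in>?I. card (?A i))"
  proof (rule card_UN_disjoint)
    show "finite ?I" by (simp add: addable_def)
    show "\<forall>i\<in>?I. finite (?A i)" using finite_SYT[OF p] by simp
    show "\<forall>i\<in>?I. \<forall>j\<in>?I. i \<noteq> j \<longrightarrow> ?A i \<inter> ?A j = {}"
    proof (intro ballI impI)
      fix i j assume ij: "i \<in> ?I" "j \<in> ?I" "i \<noteq> j"
      have "False" if T: "T \<in> SYT p q" "T (i, q i) = 1" "T (j, q j) = 1" for T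
      proof -
        have "inj_on T (skew_cells p q)" using T(1) by (simp add: SYT_def bij_betw_def)
        moreover have "(i, q i) \<in> skew_cells p q" "(j, q j) \<in> skew_cells p q"
          using ij by (auto simp: skew_cells_iff)
        ultimately have "(i, q i) = (j, q j)" using T by (metis inj_onD)
        then show False using ij(3) by simp
      qed
      then show "?A i \<inter> ?A j = {}" by blast
    qed
  qed
  ultimately show ?thesis
    unfolding num_SYT_def[of p q] using card_SYT_entry_1[OF p q] by simp
qed

lemma conjugate_antimono: "partition p \<Longrightarrow> conjugate p (Suc j) \<le> conjugate p j"
  by (metis less_conjugate_iff Suc_lessD linorder_not_less order_less_irrefl)

lemma num_SYT_self: "num_SYT p p = 1"
proof -
  have "SYT p p = {\<lambda>_. undefined}" by (auto simp: SYT_def skew_cells_def bij_betw_def)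
  then show ?thesis by (simp add: num_SYT_def)
qed

lemma excited_diagrams_self: "excited_diagrams p p = {diagram p}"
proof -
  have "D = diagram p" if "D \<in> excited_diagrams p p" for D
    using that by induction (auto simp: active_def)
  then show ?thesis using excited_diagrams.start by blast
qed

lemma card_skew_cells:
  assumes "bounded_partition N p" "diagram q \<subseteq> diagram p"
  shows "card (skew_cells p q) = (\<Sum>i<N. p i - q i)"
proof -
  have "skew_cells p q = (SIGMA i:{..<N}. {q i..<p i})"
  proof -
    have "i < N" if "j < p i" for i j using that assms(1) by (metis bounded_partition_def linorder_not_less not_less0)
    then show ?thesis by (auto simp: skew_cells_iff)
  qed
  then show ?thesis by simp
qed

section \<open>Hook lengths and the two-sided bound for the number of tableaux\<close>

lemma hook_eq:
  assumes "partition p" "(i, j) \<in> diagram p"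
  shows "real (hook p (i, j)) = (real (p i) - real i) + (real (conjugate p j) - real j - 1)"
    and "hook p (i, j) \<ge> 1"
proof -
  have "j < p i" using assms(2) by (simp add: diagram_def)
  moreover from this have "i < conjugate p j" using less_conjugate_iff[OF assms(1)] by blast
  ultimately show "real (hook p (i, j)) = (real (p i) - real i) + (real (conjugate p j) - real j - 1)"
    "hook p (i, j) \<ge> 1"
    by (auto simp: hook_def of_nat_diff)
qed

text \<open>An excited move replaces one factor by its successor on the diagonal, which is not
  larger.\<close>

lemma excited_prod_le:
  fixes w :: "nat \<times> nat \<Rightarrow> real"
  assumes fin: "finite (diagram p)" and sub: "diagram q \<subseteq> diagram p"
    and w0: "\<And>c. c \<in> diagram p \<Longrightarrow> w c \<ge> 0" and w: "\<And>i j. w (Suc i, Suc j) \<le> w (i, j)"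
    and D: "D \<in> excited_diagrams p q"
  shows "prod w D \<le> prod w (diagram q)"
  using D
proof induction
  case (move D i j)
  have sub': "D \<subseteq> diagram p" by (rule excited_subset[OF sub move.hyps(1)])
  then have finD: "finite D" using fin finite_subset by blast
  have a: "(i, j) \<in> D" "(Suc i, Suc j) \<notin> D" using move.hyps(2) by (auto simp: active_def)
  have "prod w (insert (Suc i, Suc j) (D - {(i, j)})) = w (Suc i, Suc j) * prod w (D - {(i, j)})"
    using finD a by simp
  also have "\<dots> \<le> w (i, j) * prod w (D - {(i, j)})"
    using w sub' w0 by (intro mult_right_mono prod_nonneg) auto
  also have "\<dots> = prod w D" using finD a by (simp add: prod.remove[symmetric])
  finally show ?case using move.IH by simp
qed simp

text \<open>For hook lengths the labels are the integers themselves (\<open>z\<close> is the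
  inclusion into the reals), and the Pieri factor counts the cells of the skew shape. Hence
  \<open>fact m * G q\<close> and the number of tableaux times the full hook product satisfy the
  same recursion, with equal values at \<open>q = p\<close>.\<close>

lemma naruse_bounds:
  assumes "skew_shape p q"
  defines "m \<equiv> card (skew_cells p q)" and "H \<equiv> (\<Prod>c\<in>skew_cells p q. real (hook p c))"
  shows "fact m \<le> real (num_SYT p q) * H"
    and "real (num_SYT p q) * H \<le> fact m * real (num_excited p q)"
    and "num_excited p q \<ge> 1"
proof -
  obtain N1 N2 where "bounded_partition N1 p" "bounded_partition N2 q"
    using assms(1) partition_imp_bounded unfolding skew_shape_def by blast
  then obtain N where p: "bounded_partition N p" and q: "bounded_partition N q"
    using bounded_partition_mono by (metis max.cobounded1 max.cobounded2)
  have part: "partition p" and sub: "diagram q \<subseteq> diagram p"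
    using assms(1) by (auto simp: skew_shape_def)
  have mono: "antimono p" using p by (simp add: bounded_partition_def)
  define x where "x i = real_of_int (edge p i)" for i
  define y where "y j = real (conjugate p j) - real j - 1" for j
  \<comment> \<open>Additive on all cells; off the diagram it may differ from \<open>hook\<close>,
    whose truncated subtraction would spoil additivity.\<close>
  define w where "w c = x (fst c) + y (snd c)" for c
  have hook: "w c = real (hook p c)" "w c \<ge> 1" if "c \<in> diagram p" for c
    using hook_eq[OF part, of "fst c" "snd c"] that by (auto simp: w_def x_def y_def edge_def)
  have hook0: "w c \<ge> 0" if "c \<in> diagram p" for c using hook[OF that] by simp
  have "\<exists>G. \<forall>q. bounded_partition N q \<longrightarrow>
    (\<Sum>i<N. x i - real_of_int (edge q i)) * G q = (\<Sum>i\<in>addable N q. G (add_cell q i)) \<and>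
    (diagram q \<subseteq> diagram p \<longrightarrow> prod w (diagram q) \<le> G q \<and>
       G q \<le> (\<Sum>D\<in>excited_diagrams p q. prod w D)) \<and>
    (\<not> diagram q \<subseteq> diagram p \<longrightarrow> G q = 0)"
    by (rule excited_weight_bounds[where y = y, OF _ p])
      (auto simp: w_def x_def y_def intro: hook0[unfolded w_def x_def y_def, of "(_, _)", simplified])
  then obtain G where pieri: "\<And>q. bounded_partition N q \<Longrightarrow>
      (\<Sum>i<N. x i - real_of_int (edge q i)) * G q = (\<Sum>i\<in>addable N q. G (add_cell q i))"
    and low: "\<And>q. bounded_partition N q \<Longrightarrow> diagram q \<subseteq> diagram p \<Longrightarrow> prod w (diagram q) \<le> G q"
    and up: "\<And>q. bounded_partition N q \<Longrightarrow> diagram q \<subseteq> diagram p \<Longrightarrow>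
       G q \<le> (\<Sum>D\<in>excited_diagrams p q. prod w D)"
    and zero: "\<And>q. bounded_partition N q \<Longrightarrow> \<not> diagram q \<subseteq> diagram p \<Longrightarrow> G q = 0"
    by blast
  have e: "real (num_SYT p q) * prod w (diagram p) = fact (card (skew_cells p q)) * G q"
    if "bounded_partition N q" "diagram q \<subseteq> diagram p" for q
    using that
  proof (induction "card (skew_cells p q)" arbitrary: q)
    case 0
    then have "skew_cells p q = {}" using finite_skew_cells[OF p] by auto
    then have "diagram p = diagram q" using "0.prems" by (auto simp: skew_cells_def)
    then have "q = p" using diagram_subset_iff[of p q] diagram_subset_iff[of q p] by (intro ext antisym) auto
    \<comment> \<open>At \<open>q = p\<close> there is one excited diagram, so the two bounds pinch
      \<open>G\<close>.\<close>
    moreover have "G p = prod w (diagram p)"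
      using low[OF p] up[OF p] by (simp add: excited_diagrams_self)
    ultimately show ?case by (simp add: num_SYT_self skew_cells_def)
  next
    case (Suc m)
    let ?I = "{i \<in> addable N q. q i < p i}"
    have ne: "skew_cells p q \<noteq> {}" using Suc.hyps(2) by auto
    have le: "q i \<le> p i" for i using Suc.prems(2) by (simp add: diagram_subset_iff)
    have "(\<Sum>i<N. x i - real_of_int (edge q i)) = (\<Sum>i<N. real (p i - q i))"
      using le by (intro sum.cong) (auto simp: x_def edge_def of_nat_diff)
    also have "\<dots> = real (Suc m)"
      using card_skew_cells[OF p Suc.prems(2)] Suc.hyps(2) by (simp flip: of_nat_sum)
    finally have factor: "(\<Sum>i<N. x i - real_of_int (edge q i)) = real (Suc m)" .
    have "real (num_SYT p q) * prod w (diagram p) =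
        (\<Sum>i\<in>?I. real (num_SYT p (add_cell q i)) * prod w (diagram p))"
      unfolding num_SYT_recursion[OF p Suc.prems(1) ne] by (simp add: sum_distrib_right)
    also have "\<dots> = (\<Sum>i\<in>?I. fact m * G (add_cell q i))"
    proof (rule sum.cong[OF refl])
      fix i assume i: "i \<in> ?I"
      have c: "m = card (skew_cells p (add_cell q i))"
        using i Suc.hyps(2) finite_skew_cells[OF p] by (simp add: skew_cells_add_cell skew_cells_iff)
      have "diagram (add_cell q i) \<subseteq> diagram p"
        using i le by (auto simp: diagram_subset_iff add_cell_def)
      then show "real (num_SYT p (add_cell q i)) * prod w (diagram p) = fact m * G (add_cell q i)"
        using Suc.hyps(1)[OF c bounded_partition_add_cell[OF Suc.prems(1)]] i c by simp
    qed
    \<comment> \<open>The Pieri sum also runs over shapes not inside \<open>p\<close>; there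
      \<open>G\<close> vanishes.\<close>
    also have "\<dots> = (\<Sum>i\<in>addable N q. fact m * G (add_cell q i))"
    proof (rule sum.mono_neutral_left)
      show "\<forall>i\<in>addable N q - ?I. fact m * G (add_cell q i) = 0"
      proof
        fix i assume i: "i \<in> addable N q - ?I"
        then have "\<not> add_cell q i i \<le> p i" by (auto simp: add_cell_def)
        then have "\<not> diagram (add_cell q i) \<subseteq> diagram p" unfolding diagram_subset_iff by blast
        then show "fact m * G (add_cell q i) = 0" using zero[OF bounded_partition_add_cell[OF Suc.prems(1)]] i by simp
      qed
    qed (auto simp: addable_def)
    also have "\<dots> = fact m * (real (Suc m) * G q)"
      using pieri[OF Suc.prems(1)] factor by (simp add: sum_distrib_left)
    also have "\<dots> = fact (card (skew_cells p q)) * G q"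
      using Suc.hyps(2)[symmetric] by (simp add: algebra_simps)
    finally show ?case .
  qed
  have fin: "finite (diagram p)" by (rule finite_diagram[OF p])
  have pos: "prod w (diagram q) > 0"
    using hook sub by (intro prod_pos) force
  have split: "prod w (diagram p) = prod w (diagram q) * H"
  proof -
    have "prod w (diagram p) = prod w (diagram p - diagram q) * prod w (diagram q)"
      using fin sub by (rule prod.subset_diff[rotated])
    moreover have "prod w (diagram p - diagram q) = H"
      unfolding H_def skew_cells_def using hook by (intro prod.cong) auto
    ultimately show ?thesis by simp
  qed
  have E: "prod w (diagram q) * (real (num_SYT p q) * H) = fact m * G q"
    using e[OF q sub] by (simp add: split m_def mult_ac)
  have "prod w (diagram q) * fact m \<le> prod w (diagram q) * (real (num_SYT p q) * H)"
    unfolding E using low[OF q sub] by simp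
  then show "fact m \<le> real (num_SYT p q) * H" using pos by simp
  have "G q \<le> (\<Sum>D\<in>excited_diagrams p q. prod w (diagram q))"
  proof (rule order_trans[OF up[OF q sub] sum_mono])
    fix D assume D: "D \<in> excited_diagrams p q"
    show "prod w D \<le> prod w (diagram q)"
    proof (rule excited_prod_le[OF fin sub hook0 _ D])
      fix i j
      have "edge p (Suc i) < edge p i" by (rule edge_less[OF mono]) simp
      then show "w (Suc i, Suc j) \<le> w (i, j)"
        using conjugate_antimono[OF part, of j] by (simp add: w_def x_def y_def)
    qed
  qed
  then have "G q \<le> prod w (diagram q) * real (num_excited p q)" by (simp add: num_excited_def mult.commute)
  then have "prod w (diagram q) * (real (num_SYT p q) * H) \<le>
      prod w (diagram q) * (fact m * real (num_excited p q))"
    unfolding E by (simp add: mult.left_commute)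
  then show "real (num_SYT p q) * H \<le> fact m * real (num_excited p q)" using pos by simp
  show "num_excited p q \<ge> 1"
    using finite_excited[OF p sub] excited_diagrams.start[of q p]
    by (auto simp: num_excited_def Suc_le_eq card_gt_0_iff)
qed

section \<open>Measure and Stirling estimates\<close>

lemma reflect_emeasure_lborel:
  assumes "A \<in> sets borel"
  shows "emeasure lborel ((\<lambda>t::real. c - t) -` A) = emeasure lborel A"
proof -
  have "lborel = density (distr lborel borel (\<lambda>t::real. c + (-1) * t)) (\<lambda>_. ennreal \<bar>-1\<bar>)"
    by (rule lborel_real_affine) simp
  then have "lborel = distr lborel borel (\<lambda>t::real. c - t)"
    by (simp add: density_1)
  then have "emeasure lborel A = emeasure (distr lborel borel (\<lambda>t::real. c - t)) A" by simp
  also have "\<dots> = emeasure lborel ((\<lambda>t::real. c - t) -` A)"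
    using assms by (subst emeasure_distr) auto
  finally show ?thesis by simp
qed

lemma sets_lborel_pair: "sets (lborel \<Otimes>\<^sub>M lborel) = sets (borel :: (real \<times> real) measure)"
  by (subst lborel_prod) simp

text \<open>On each vertical line the map is a reflection, which preserves length; Tonelli does the
  rest.\<close>

lemma shear_distr:
  fixes g :: "real \<Rightarrow> real"
  assumes [measurable]: "g \<in> borel_measurable borel"
  shows "distr lborel lborel (\<lambda>(x, t). (x, g x - t)) = (lborel :: (real \<times> real) measure)"
proof (rule measure_eqI)
  show "sets (distr lborel lborel (\<lambda>(x, t). (x, g x - t))) = sets (lborel :: (real \<times> real) measure)"
    by simp
  fix A assume "A \<in> sets (distr lborel lborel (\<lambda>(x::real, t). (x, g x - t)))"
  then have A: "A \<in> sets (lborel \<Otimes>\<^sub>M lborel)" unfolding sets_lborel_pair by simp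
  let ?T = "\<lambda>(x::real, t). (x, g x - t)"
  have T: "?T \<in> measurable (lborel \<Otimes>\<^sub>M lborel) (lborel \<Otimes>\<^sub>M lborel)" by measurable
  have TA: "?T -` A \<in> sets (lborel \<Otimes>\<^sub>M lborel)"
    using measurable_sets[OF T A] by (simp add: space_pair_measure)
  have "emeasure (distr (lborel \<Otimes>\<^sub>M lborel) (lborel \<Otimes>\<^sub>M lborel) ?T) A =
      emeasure (lborel \<Otimes>\<^sub>M lborel) (?T -` A)"
    by (subst emeasure_distr[OF T A]) (simp add: space_pair_measure)
  then have "emeasure (distr lborel lborel ?T) A = emeasure (lborel \<Otimes>\<^sub>M lborel) (?T -` A)"
    by (simp only: lborel_prod)
  also have "\<dots> = (\<integral>\<^sup>+x. emeasure lborel (Pair x -` (?T -` A)) \<partial>lborel)"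
    by (rule lborel.emeasure_pair_measure_alt[OF TA])
  also have "\<dots> = (\<integral>\<^sup>+x. emeasure lborel (Pair x -` A) \<partial>lborel)"
  proof (rule nn_integral_cong)
    fix x :: real
    have "Pair x -` (?T -` A) = (\<lambda>t. g x - t) -` (Pair x -` A)" by auto
    moreover have "Pair x -` A \<in> sets borel" using sets_Pair1[OF A, of x] by simp
    ultimately show "emeasure lborel (Pair x -` (?T -` A)) = emeasure lborel (Pair x -` A)"
      using reflect_emeasure_lborel by simp
  qed
  also have "\<dots> = emeasure (lborel \<Otimes>\<^sub>M lborel) A"
    by (rule lborel.emeasure_pair_measure_alt[OF A, symmetric])
  finally show "emeasure (distr lborel lborel ?T) A = emeasure lborel A" by (simp add: lborel_prod)
qed

text \<open>Each vertical section of the graph is a single point.\<close>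

lemma AE_lborel_not_graph:
  fixes g :: "real \<Rightarrow> real"
  assumes [measurable]: "g \<in> borel_measurable borel"
  shows "AE z in lborel. snd z \<noteq> g (fst z)"
proof -
  have "{z \<in> space (lborel \<Otimes>\<^sub>M lborel). snd z \<noteq> g (fst z)} \<in> sets (lborel \<Otimes>\<^sub>M (lborel :: real measure))"
    by measurable
  then have "AE z in lborel \<Otimes>\<^sub>M (lborel :: real measure). snd z \<noteq> g (fst z)"
    by (rule lborel_pair.AE_pair_measure) (simp add: AE_lborel_singleton)
  then show ?thesis unfolding lborel_prod .
qed

lemma AE_lborel_fst_neq: "AE z in (lborel :: (real \<times> real) measure). fst z \<noteq> c"
proof -
  have "{z \<in> space (lborel \<Otimes>\<^sub>M lborel). fst z \<noteq> c} \<in> sets (lborel \<Otimes>\<^sub>M (lborel :: real measure))"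
    by measurable
  then have "AE z in lborel \<Otimes>\<^sub>M (lborel :: real measure). fst z \<noteq> c"
    by (rule lborel_pair.AE_pair_measure) (use AE_lborel_singleton[of c] in \<open>auto elim!: eventually_mono\<close>)
  then show ?thesis unfolding lborel_prod .
qed

section \<open>Step functions on a mesh of width 1/s\<close>

definition grid :: "real \<Rightarrow> nat \<Rightarrow> real set" where
  "grid s i = {real i / s..<(real i + 1) / s}"

lemma grid_iff: "s > 0 \<Longrightarrow> x \<in> grid s i \<longleftrightarrow> 0 \<le> x \<and> i = nat \<lfloor>x * s\<rfloor>"
proof -
  assume s: "s > 0"
  have "x \<in> grid s i \<longleftrightarrow> real i \<le> x * s \<and> x * s < real i + 1"
    using s by (simp add: grid_def field_simps)
  also have "\<dots> \<longleftrightarrow> \<lfloor>x * s\<rfloor> = int i" by (simp add: floor_eq_iff)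
  also have "\<dots> \<longleftrightarrow> 0 \<le> x \<and> i = nat \<lfloor>x * s\<rfloor>"
    using s by (auto simp: zero_le_mult_iff nat_eq_iff) (metis floor_mono floor_zero of_nat_0_le_iff zero_le_mult_iff zero_le_floor less_eq_real_def not_less of_int_0_le_iff)
  finally show ?thesis .
qed

lemma grid_measure:
  assumes "s > 0"
  shows "grid s i \<in> sets borel" "emeasure lborel (grid s i) = ennreal (1 / s)"
    "measure lborel (grid s i) = 1 / s"
proof -
  have le: "real i / s \<le> (real i + 1) / s" using assms by (simp add: divide_right_mono)
  have d: "(real i + 1) / s - real i / s = 1 / s" by (simp add: diff_divide_distrib[symmetric])
  show "grid s i \<in> sets borel" "emeasure lborel (grid s i) = ennreal (1 / s)"
    using le by (simp_all add: grid_def d)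
  show "measure lborel (grid s i) = 1 / s"
    using le by (simp add: grid_def d)
qed

lemma integral_grid_sum:
  fixes f :: "nat \<Rightarrow> real"
  assumes s: "s > 0" and I: "finite I"
  shows "has_bochner_integral lborel (\<lambda>x. \<Sum>i\<in>I. f i * indicator (grid s i) x) ((\<Sum>i\<in>I. f i) / s)"
proof -
  have "has_bochner_integral lborel (\<lambda>x. \<Sum>i\<in>I. f i * indicator (grid s i) x) (\<Sum>i\<in>I. f i * (1 / s))"
  proof (rule has_bochner_integral_sum)
    fix i assume "i \<in> I"
    have "has_bochner_integral lborel (indicator (grid s i) :: real \<Rightarrow> real) (measure lborel (grid s i))"
      by (rule has_bochner_integral_real_indicator) (use grid_measure[OF s] in auto)
    then show "has_bochner_integral lborel (\<lambda>x. f i * indicator (grid s i) x) (f i * (1 / s))"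
      unfolding grid_measure[OF s] by (rule has_bochner_integral_mult_right)
  qed
  then show ?thesis by (simp add: sum_divide_distrib)
qed

lemma integral_grid_sum2:
  fixes f :: "nat \<times> nat \<Rightarrow> real"
  assumes s: "s > 0" and I: "finite I"
  shows "has_bochner_integral lborel
    (\<lambda>z. \<Sum>c\<in>I. f c * indicator (grid s (fst c) \<times> grid s (snd c)) z) ((\<Sum>c\<in>I. f c) / s\<^sup>2)"
proof -
  have "has_bochner_integral lborel
    (\<lambda>z. \<Sum>c\<in>I. f c * indicator (grid s (fst c) \<times> grid s (snd c)) z) (\<Sum>c\<in>I. f c * (1 / s\<^sup>2))"
  proof (rule has_bochner_integral_sum)
    fix c assume "c \<in> I"
    let ?B = "grid s (fst c) \<times> grid s (snd c)"
    have B: "?B \<in> sets borel" unfolding sets_lborel_pair[symmetric] using grid_measure(1)[OF s] by auto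
    have e: "emeasure lborel ?B = ennreal (1 / s\<^sup>2)"
      using grid_measure(1,2)[OF s] s
      by (simp add: lborel_prod[symmetric] lborel.emeasure_pair_measure_Times ennreal_mult[symmetric] power2_eq_square)
    have "has_bochner_integral lborel (indicator ?B :: real \<times> real \<Rightarrow> real) (measure lborel ?B)"
      by (rule has_bochner_integral_real_indicator) (use B e in auto)
    moreover have "measure lborel ?B = 1 / s\<^sup>2" using e by (simp add: measure_def)
    ultimately show "has_bochner_integral lborel (\<lambda>z. f c * indicator ?B z) (f c * (1 / s\<^sup>2))"
      by (metis has_bochner_integral_mult_right)
  qed
  then show ?thesis by (simp add: sum_divide_distrib)
qed

section \<open>Crude Stirling bounds and integrability of the logarithm\<close>

lemma ln_fact_lower: "n \<ge> 1 \<Longrightarrow> real n * ln (real n) - real n \<le> ln (fact n)"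
proof (induction n rule: nat_induct_at_least)
  case (Suc n)
  have n: "real n > 0" using Suc.hyps by simp
  have "ln ((real n + 1) / real n) \<le> (real n + 1) / real n - 1"
    using n by (intro ln_le_minus_one) auto
  then have "ln (real n + 1) - ln (real n) \<le> 1 / real n"
    using n by (simp add: ln_div field_simps)
  then have "real n * (ln (real n + 1) - ln (real n)) \<le> 1"
    using n by (simp add: field_simps)
  moreover have "ln (fact (Suc n)) = ln (real n + 1) + ln (fact n)"
    using n by (simp add: ln_mult add.commute)
  ultimately show ?case using Suc.IH by (simp add: algebra_simps)
qed simp

text \<open>The gap to \<open>ln_fact_lower\<close> is of order ln n, negligible against n. The two
  inductions compare ln (n + 1) - ln n with 1/(n + 1) and 1/n.\<close>

lemma ln_fact_upper: "n \<ge> 1 \<Longrightarrow> ln (fact n) \<le> real n * ln (real n) - real n + ln (real n) + 1"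
proof (induction n rule: nat_induct_at_least)
  case (Suc n)
  have n: "real n > 0" using Suc.hyps by simp
  have "ln (real n / (real n + 1)) \<le> real n / (real n + 1) - 1"
    using n by (intro ln_le_minus_one) auto
  then have "1 / (real n + 1) \<le> ln (real n + 1) - ln (real n)"
    using n by (simp add: ln_div field_simps)
  then have "1 \<le> (real n + 1) * (ln (real n + 1) - ln (real n))"
    using n by (simp add: field_simps)
  moreover have "ln (fact (Suc n)) = ln (real n + 1) + ln (fact n)"
    using n by (simp add: ln_mult add.commute)
  ultimately show ?case using Suc.IH by (simp add: algebra_simps)
qed simp

text \<open>Comes from \<open>ln u \<le> u\<close> for \<open>u = t powr (-1/2)\<close>; the
  exponent exceeds -1, so the bound is integrable at 0. At \<open>t = 0\<close> both sides are 0 by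
  the conventions for \<open>ln\<close> and \<open>powr\<close>.\<close>

lemma abs_ln_le_powr:
  assumes "(t::real) \<ge> 0" shows "\<bar>ln t\<bar> \<le> 2 * t powr (-1/2) + t"
proof (cases "t = 0")
  case False
  then have t: "t > 0" using assms by simp
  have "ln t \<le> t" using ln_le_minus_one[OF t] by simp
  moreover have "- ln t = 2 * ln (t powr (-1/2))" using t by (simp add: ln_powr)
  moreover have "ln (t powr (-1/2)) \<le> t powr (-1/2)"
    using ln_le_minus_one[of "t powr (-1/2)"] t by simp
  moreover have "t powr (-1/2) \<ge> 0" by simp
  ultimately show ?thesis using t by linarith
qed simp

lemma integrable_ln_rectangle:
  assumes A: "A \<ge> 0" and B: "B \<ge> 0"
  shows "integrable lborel (\<lambda>z::real \<times> real. indicator ({0..A} \<times> {0..B}) z * (\<bar>ln (snd z)\<bar> + K))"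
proof -
  let ?h = "\<lambda>t::real. indicator {0..B} t * \<bar>ln t\<bar>"
  have "set_integrable lebesgue {0..B} (\<lambda>t::real. t powr (-1/2))"
    using integrable_on_powr_from_0[of "-1/2" B] B
    by (intro nonnegative_absolutely_integrable_1) auto
  then have "integrable lborel (\<lambda>t. indicator {0..B} t * t powr (-1/2))"
    by (simp add: set_integrable_def integrable_completion)
  moreover have "integrable lborel (\<lambda>t::real. indicator {0..B} t * t)"
    using borel_integrable_atLeastAtMost'[of 0 B "\<lambda>t::real. t"]
    by (simp add: set_integrable_def continuous_on_id)
  ultimately have 1: "integrable lborel (\<lambda>t::real. 2 * (indicator {0..B} t * t powr (-1/2)) + indicator {0..B} t * t)"
    by simp
  have h: "integrable lborel ?h"
    by (rule Bochner_Integration.integrable_bound[OF 1])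
      (use abs_ln_le_powr in \<open>auto simp: indicator_def intro!: AE_I2\<close>)
  have K: "integrable lborel (\<lambda>t::real. indicator {0..B} t * (K::real))"
    using B by simp
  have hK: "integrable lborel (\<lambda>t::real. indicator {0..B} t * (\<bar>ln t\<bar> + K))"
    using Bochner_Integration.integrable_add[OF h K] by (simp add: algebra_simps)
  let ?f = "\<lambda>z::real \<times> real. indicator {0..A} (fst z) * (indicator {0..B} (snd z) * (\<bar>ln (snd z)\<bar> + K))"
  have "integrable (lborel \<Otimes>\<^sub>M lborel) ?f"
  proof (rule lborel_pair.Fubini_integrable)
    show "?f \<in> borel_measurable (lborel \<Otimes>\<^sub>M lborel)" by measurable
    have "integrable lborel (\<lambda>x::real. indicator {0..A} x * (\<integral>y. norm (indicator {0..B} y * (\<bar>ln y\<bar> + K)) \<partial>lborel))"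
      using A by simp
    then show "integrable lborel (\<lambda>x. \<integral>y. norm (?f (x, y)) \<partial>lborel)"
      by (simp add: abs_mult)
    show "AE x in lborel. integrable lborel (\<lambda>y. ?f (x, y))" using hK by simp
  qed
  then show ?thesis by (simp add: lborel_prod indicator_times mult.assoc)
qed

section \<open>Strongly stable shapes\<close>

locale shape =
  fixes a b :: real and f :: "real \<Rightarrow> real"
  assumes a_pos: "0 < a" and f_range: "f \<in> {0..a} \<rightarrow> {0..b}"
    and f_cont: "continuous_on {0..a} f" and f_anti: "antimono_on {0..a} f"
begin

text \<open>Extending by 0 makes the row estimates below valid for all rows, including those beyond \<open>a\<close>.\<close>

definition W :: "real \<Rightarrow> real" where
  "W x = (if 0 \<le> x \<and> x \<le> a then f x else 0)"

lemma W_nonneg: "0 \<le> W x"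
  using f_range by (auto simp: W_def)

lemma b_nonneg: "0 \<le> b"
  using f_range a_pos by (force simp: Pi_iff)

lemma W_le: "W x \<le> b"
  using f_range b_nonneg by (auto simp: W_def)

lemma W_anti: "0 \<le> x \<Longrightarrow> x \<le> y \<Longrightarrow> W y \<le> W x"
  using f_anti f_range by (auto simp: W_def monotone_on_def)

text \<open>The extension by 0 may jump at \<open>0\<close> and at \<open>a\<close>; both abscissae
  are discarded later as null.\<close>

lemma W_cont:
  assumes "x > 0" "x \<noteq> a" shows "isCont W x"
proof (cases "x < a")
  case True
  have "continuous_on {0<..<a} f" using f_cont by (rule continuous_on_subset) auto
  then have "isCont f x" using assms True by (simp add: continuous_on_eq_continuous_at)
  moreover have "eventually (\<lambda>y. W y = f y) (nhds x)"
    using eventually_nhds_in_open[of "{0<..<a}" x] assms True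
    by (auto simp: W_def elim!: eventually_mono)
  ultimately show ?thesis using isCont_cong by blast
next
  case False
  then have "x > a" using assms by simp
  then have "eventually (\<lambda>y. W y = 0) (nhds x)"
    using eventually_nhds_in_open[of "{a<..}" x]
    by (auto simp: W_def elim!: eventually_mono)
  then show ?thesis using isCont_cong[of W "\<lambda>_. 0" x] by simp
qed

lemma W_eq: "W = (\<lambda>x. indicator {0..a} x *\<^sub>R f x)"
  by (auto simp: W_def)

lemma W_borel [measurable]: "W \<in> borel_measurable borel"
  unfolding W_eq by (rule borel_measurable_continuous_on_indicator) (use f_cont in auto)

lemma W_integrable: "integrable lborel W"
  using borel_integrable_atLeastAtMost'[OF f_cont] by (simp add: W_eq set_integrable_def)

end

section \<open>Rescaled integer parts, then rows and columns of a stable sequence\<close>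

lemma nat_floor_sqrt_tendsto:
  assumes "x \<ge> 0"
  shows "(\<lambda>n. real (nat \<lfloor>x * sqrt (real n)\<rfloor>) / sqrt (real n)) \<longlonglongrightarrow> x"
proof (rule tendsto_sandwich[of "\<lambda>n. x - 1 / sqrt (real n)" _ _ "\<lambda>n. x"])
  have inv: "(\<lambda>n. 1 / sqrt (real n)) \<longlonglongrightarrow> 0"
    by (rule tendsto_divide_0[OF tendsto_const])
      (rule filterlim_at_top_imp_at_infinity, rule filterlim_compose[OF sqrt_at_top filterlim_real_sequentially])
  show "(\<lambda>n. x - 1 / sqrt (real n)) \<longlonglongrightarrow> x" using tendsto_diff[OF tendsto_const inv] by simp
  have fl: "real (nat \<lfloor>x * sqrt (real n)\<rfloor>) = of_int \<lfloor>x * sqrt (real n)\<rfloor>" for n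
    using assms by simp
  show "\<forall>\<^sub>F n in sequentially. x - 1 / sqrt (real n) \<le> real (nat \<lfloor>x * sqrt (real n)\<rfloor>) / sqrt (real n)"
    using eventually_gt_at_top[of 0]
  proof eventually_elim
    case (elim n)
    then have "(x * sqrt (real n) - 1) / sqrt (real n) \<le> real (nat \<lfloor>x * sqrt (real n)\<rfloor>) / sqrt (real n)"
      unfolding fl by (intro divide_right_mono) (linarith, simp)
    then show ?case using elim by (simp add: diff_divide_distrib)
  qed
  show "\<forall>\<^sub>F n in sequentially. real (nat \<lfloor>x * sqrt (real n)\<rfloor>) / sqrt (real n) \<le> x"
    using eventually_gt_at_top[of 0]
  proof eventually_elim
    case (elim n)
    then have "real (nat \<lfloor>x * sqrt (real n)\<rfloor>) / sqrt (real n) \<le> x * sqrt (real n) / sqrt (real n)"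
      unfolding fl by (intro divide_right_mono) (linarith, simp)
    then show ?case using elim by simp
  qed
qed simp

lemma sqrt_at_top_nat: "filterlim (\<lambda>n. sqrt (real n)) at_top sequentially"
  by (rule filterlim_compose[OF sqrt_at_top filterlim_real_sequentially])

lemma inverse_sqrt_tendsto: "(\<lambda>n. c / sqrt (real n)) \<longlonglongrightarrow> 0"
  by (rule tendsto_divide_0[OF tendsto_const filterlim_at_top_imp_at_infinity[OF sqrt_at_top_nat]])

lemma sqrt_shift_ratio: "(\<lambda>n. (sqrt (real n) + c) / sqrt (real n)) \<longlonglongrightarrow> 1"
proof -
  have "(\<lambda>n. 1 + c / sqrt (real n)) \<longlonglongrightarrow> 1 + 0"
    by (intro tendsto_add tendsto_const inverse_sqrt_tendsto)
  moreover have "\<forall>\<^sub>F n in sequentially. 1 + c / sqrt (real n) = (sqrt (real n) + c) / sqrt (real n)"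
    using eventually_gt_at_top[of 0] by eventually_elim (simp add: add_divide_distrib)
  ultimately show ?thesis using Lim_transform_eventually by force
qed

text \<open>The right end of the row containing \<open>x * sqrt n\<close>, rescaled by a dilation
  factor of strong stability; \<open>c\<close> will be \<open>L\<close> or
  \<open>- L\<close>.\<close>

lemma grid_point_tendsto:
  assumes "x \<ge> 0"
  shows "(\<lambda>n. (real (nat \<lfloor>x * sqrt (real n)\<rfloor>) + 1) / (sqrt (real n) + c)) \<longlonglongrightarrow> x"
proof -
  have "(\<lambda>n. (real (nat \<lfloor>x * sqrt (real n)\<rfloor>) / sqrt (real n) + 1 / sqrt (real n)) /
      ((sqrt (real n) + c) / sqrt (real n))) \<longlonglongrightarrow> (x + 0) / 1"
    by (intro tendsto_divide tendsto_add nat_floor_sqrt_tendsto inverse_sqrt_tendsto sqrt_shift_ratio assms) simp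
  moreover have "\<forall>\<^sub>F n in sequentially. (real (nat \<lfloor>x * sqrt (real n)\<rfloor>) / sqrt (real n) + 1 / sqrt (real n)) /
      ((sqrt (real n) + c) / sqrt (real n)) = (real (nat \<lfloor>x * sqrt (real n)\<rfloor>) + 1) / (sqrt (real n) + c)"
    using eventually_gt_at_top[of 0]
    by eventually_elim (simp add: add_divide_distrib[symmetric])
  ultimately show ?thesis using Lim_transform_eventually by force
qed

locale stable_shape = shape +
  fixes p :: "nat \<Rightarrow> nat \<Rightarrow> nat"
  assumes stable: "strongly_stable a f p" and part: "\<And>n. partition (p n)"
begin

lemma mono: "i \<le> j \<Longrightarrow> p n j \<le> p n i"
  using part[of n] by (simp add: partition_def antimono_def)

text \<open>Upper bound: the outer corner \<open>(i + 1, p n i)\<close> lies in the larger dilation.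
  Lower bound: the boundary point of the smaller dilation at abscissa \<open>z\<close> lies in some
  row \<open>l \<ge> i\<close>, and rows decrease; \<open>z > i\<close> is strict because row
  \<open>i - 1\<close> also contains the abscissa \<open>i\<close>.\<close>

lemma row_bounds:
  obtains L where "L > 0" "\<forall>\<^sub>F n in sequentially. sqrt (real n) > L \<and> sqrt (real n) \<ge> 1 \<and>
    (\<forall>i. real (p n i) \<le> (sqrt (real n) + L) * W ((real i + 1) / (sqrt (real n) + L))) \<and>
    (\<forall>i z. z > real i \<longrightarrow> (sqrt (real n) - L) * W (z / (sqrt (real n) - L)) \<le> real (p n i))"
proof -
  obtain L where L: "L > 0" and ev: "\<forall>\<^sub>F n in sequentially.
     (\<lambda>z. (sqrt (real n) - L) *\<^sub>R z) ` subgraph a f \<subseteq> young_region (p n) \<and>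
     young_region (p n) \<subseteq> (\<lambda>z. (sqrt (real n) + L) *\<^sub>R z) ` subgraph a f \<union> {(x, y). y = 0}"
    using stable unfolding strongly_stable_def by blast
  have "\<forall>\<^sub>F n in sequentially. sqrt (real n) > L"
    using sqrt_at_top_nat by (simp add: filterlim_at_top_dense)
  moreover have "\<forall>\<^sub>F n in sequentially. sqrt (real n) \<ge> 1"
    using eventually_ge_at_top[of 1] by eventually_elim simp
  ultimately have "\<forall>\<^sub>F n in sequentially. sqrt (real n) > L \<and> sqrt (real n) \<ge> 1 \<and>
    (\<forall>i. real (p n i) \<le> (sqrt (real n) + L) * W ((real i + 1) / (sqrt (real n) + L))) \<and>
    (\<forall>i z. z > real i \<longrightarrow> (sqrt (real n) - L) * W (z / (sqrt (real n) - L)) \<le> real (p n i))"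
    using ev
  proof eventually_elim
    case (elim n)
    define s where "s = sqrt (real n) + L"
    define s' where "s' = sqrt (real n) - L"
    have s: "s > 0" and s': "s' > 0" using elim L by (auto simp: s_def s'_def)
    have up: "real (p n i) \<le> s * W ((real i + 1) / s)" for i
    \<comment> \<open>An empty row meets the axis only, where stability gives no
      information.\<close>
    proof (cases "p n i = 0")
      case True
      then show ?thesis using s W_nonneg by simp
    next
      case False
      have "(real i + 1, real (p n i)) \<in> young_region (p n)"
        by (auto simp: young_region_def intro!: exI[of _ i])
      then have "(real i + 1, real (p n i)) \<in> (\<lambda>z. s *\<^sub>R z) ` subgraph a f"
        using elim False unfolding s_def by auto
      then obtain x y where "(x, y) \<in> subgraph a f" "real i + 1 = s * x" "real (p n i) = s * y"
        by auto
      then show ?thesis using s by (simp add: subgraph_def W_def)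
    qed
    have low: "s' * W (z / s') \<le> real (p n i)" if "z > real i" for i z
    proof (cases "z / s' \<le> a")
      case True
      have z: "z / s' \<ge> 0" using that s' by simp
      then have "(z / s', f (z / s')) \<in> subgraph a f"
        using True f_range by (auto simp: subgraph_def)
      then have "s' *\<^sub>R (z / s', f (z / s')) \<in> young_region (p n)"
        using elim unfolding s'_def by blast
      then have "(z, s' * f (z / s')) \<in> young_region (p n)" using s' by simp
      then obtain l where l: "real l \<le> z" "z \<le> real l + 1" "s' * f (z / s') \<le> real (p n l)"
        by (auto simp: young_region_def)
      then have "i \<le> l" using that by linarith
      then show ?thesis using l mono[of i l n] True z by (simp add: W_def)
    qed (use that s' in \<open>simp add: W_def\<close>)
    show ?case using elim up low unfolding s_def s'_def by blast
  qed
  then show ?thesis using that L by blast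
qed

text \<open>With the mesh width \<open>1 / s\<close> matched to the dilation \<open>s\<close>, the
  row function compares pointwise with \<open>s * W\<close>. This gives
  \<open>s'\<^sup>2 * I\<close> and \<open>s\<^sup>2 * I\<close> as bounds, and both squares are n +
  O(sqrt n).\<close>

lemma size_bound:
  "\<exists>K. \<forall>\<^sub>F n in sequentially. \<bar>real (card (diagram (p n))) - real n * integral\<^sup>L lborel W\<bar> \<le> K * sqrt (real n)"
proof -
  obtain L where L: "L > 0" and ev: "\<forall>\<^sub>F n in sequentially. sqrt (real n) > L \<and> sqrt (real n) \<ge> 1 \<and>
    (\<forall>i. real (p n i) \<le> (sqrt (real n) + L) * W ((real i + 1) / (sqrt (real n) + L))) \<and>
    (\<forall>i z. z > real i \<longrightarrow> (sqrt (real n) - L) * W (z / (sqrt (real n) - L)) \<le> real (p n i))"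
    by (rule row_bounds)
  define I where "I = integral\<^sup>L lborel W"
  have I: "I \<ge> 0" unfolding I_def by (rule integral_nonneg_AE) (simp add: W_nonneg)
  have "\<forall>\<^sub>F n in sequentially. \<bar>real (card (diagram (p n))) - real n * I\<bar> \<le> ((2 * L + L\<^sup>2) * I) * sqrt (real n)"
    using ev
  proof eventually_elim
    case (elim n)
    define s where "s = sqrt (real n) + L"
    define s' where "s' = sqrt (real n) - L"
    have s: "s > 0" and s': "s' > 0" using elim L by (auto simp: s_def s'_def)
    obtain N where N: "bounded_partition N (p n)" using partition_imp_bounded[OF part] by blast
    have card: "real (card (diagram (p n))) = (\<Sum>i<N. real (p n i))"
      using card_skew_cells[OF N, of "\<lambda>_. 0"] by (simp add: skew_cells_def diagram_def)
    define g where "g s x = (\<Sum>i<N. real (p n i) * indicator (grid s i) x)" for s x :: real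
    have g_int: "has_bochner_integral lborel (g t) (real (card (diagram (p n))) / t)" if "t > 0" for t
      unfolding g_def card by (rule integral_grid_sum[OF that]) simp
    have g: "g t x = (if x \<ge> 0 then real (p n (nat \<lfloor>x * t\<rfloor>)) else 0)" if "t > 0" for t x
    proof -
      have "g t x = (\<Sum>i<N. if i = nat \<lfloor>x * t\<rfloor> then (if x \<ge> 0 then real (p n i) else 0) else 0)"
        unfolding g_def by (rule sum.cong) (auto simp: indicator_def grid_iff[OF that])
      also have "\<dots> = (if nat \<lfloor>x * t\<rfloor> < N then (if x \<ge> 0 then real (p n (nat \<lfloor>x * t\<rfloor>)) else 0) else 0)"
        by (simp add: sum.delta)
      finally show ?thesis using N by (auto simp: bounded_partition_def)
    qed
    have "real (card (diagram (p n))) / s \<le> s * I"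
    proof -
      have "integral\<^sup>L lborel (g s) \<le> integral\<^sup>L lborel (\<lambda>x. s * W x)"
      proof (rule integral_mono)
        show "integrable lborel (g s)" by (rule integrable.intros[OF g_int[OF s]])
        show "integrable lborel (\<lambda>x. s * W x)" using W_integrable by simp
        fix x :: real
        show "g s x \<le> s * W x"
        proof (cases "x \<ge> 0")
          case True
          have "x * s \<le> real (nat \<lfloor>x * s\<rfloor>) + 1" using True s by linarith
          then have "x \<le> (real (nat \<lfloor>x * s\<rfloor>) + 1) / s" using s by (simp add: field_simps)
          then have "W ((real (nat \<lfloor>x * s\<rfloor>) + 1) / s) \<le> W x" using W_anti True by blast
          then have "s * W ((real (nat \<lfloor>x * s\<rfloor>) + 1) / s) \<le> s * W x" using s by simp
          then show ?thesis using elim True unfolding g[OF s] s_def[symmetric] by (auto intro: order_trans)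
        qed (use s W_nonneg in \<open>simp add: g[OF s]\<close>)
      qed
      then show ?thesis using has_bochner_integral_integral_eq[OF g_int[OF s]] by (simp add: I_def)
    qed
    then have up: "real (card (diagram (p n))) \<le> s\<^sup>2 * I" using s by (simp add: field_simps power2_eq_square)
    have "s' * I \<le> real (card (diagram (p n))) / s'"
    proof -
      have "integral\<^sup>L lborel (\<lambda>x. s' * W x) \<le> integral\<^sup>L lborel (g s')"
      proof (rule integral_mono_AE)
        show "integrable lborel (g s')" by (rule integrable.intros[OF g_int[OF s']])
        show "integrable lborel (\<lambda>x. s' * W x)" using W_integrable by simp
        \<comment> \<open>The lower row bound is strict in \<open>z\<close>, so mesh points are set
          aside.\<close>
        have "AE x in lborel. \<forall>i. x \<noteq> real i / s'"
          unfolding AE_all_countable using AE_lborel_singleton by blast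
        then show "AE x in lborel. s' * W x \<le> g s' x"
        proof (rule eventually_mono)
          fix x assume x: "\<forall>i. x \<noteq> real i / s'"
          show "s' * W x \<le> g s' x"
          proof (cases "x \<ge> 0")
            case True
            have "real (nat \<lfloor>x * s'\<rfloor>) \<le> x * s'" using True s' by simp
            moreover have "real (nat \<lfloor>x * s'\<rfloor>) \<noteq> x * s'" using x s' by (metis nonzero_mult_div_cancel_right order_less_irrefl)
            ultimately have "x * s' > real (nat \<lfloor>x * s'\<rfloor>)" by linarith
            then have "s' * W (x * s' / s') \<le> real (p n (nat \<lfloor>x * s'\<rfloor>))"
              using elim unfolding s'_def by blast
            then show ?thesis using True s' by (simp add: g[OF s'])
          qed (simp add: g[OF s'] W_def)
        qed
      qed
      then show ?thesis using has_bochner_integral_integral_eq[OF g_int[OF s']] by (simp add: I_def)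
    qed
    then have low: "s'\<^sup>2 * I \<le> real (card (diagram (p n)))" using s' by (simp add: field_simps power2_eq_square)
    have sq: "s\<^sup>2 = real n + 2 * L * sqrt (real n) + L\<^sup>2" "s'\<^sup>2 = real n - 2 * L * sqrt (real n) + L\<^sup>2"
      by (simp_all add: s_def s'_def power2_eq_square algebra_simps)
    have "L\<^sup>2 * I \<le> L\<^sup>2 * I * sqrt (real n)" using elim I mult_left_mono[of 1 "sqrt (real n)" "L\<^sup>2 * I"] by simp
    moreover have "0 \<le> L\<^sup>2 * I" using I by simp
    ultimately show ?case using up low unfolding sq abs_le_iff by (simp add: algebra_simps)
  qed
  then show ?thesis unfolding I_def by blast
qed

lemma row_tendsto:
  assumes "x > 0" "x \<noteq> a"
  shows "(\<lambda>n. real (p n (nat \<lfloor>x * sqrt (real n)\<rfloor>)) / sqrt (real n)) \<longlonglongrightarrow> W x"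
proof -
  obtain L where L: "L > 0" and ev: "\<forall>\<^sub>F n in sequentially. sqrt (real n) > L \<and> sqrt (real n) \<ge> 1 \<and>
    (\<forall>i. real (p n i) \<le> (sqrt (real n) + L) * W ((real i + 1) / (sqrt (real n) + L))) \<and>
    (\<forall>i z. z > real i \<longrightarrow> (sqrt (real n) - L) * W (z / (sqrt (real n) - L)) \<le> real (p n i))"
    by (rule row_bounds)
  let ?i = "\<lambda>n. nat \<lfloor>x * sqrt (real n)\<rfloor>"
  define B where "B c n = (sqrt (real n) + c) / sqrt (real n) * W ((real (?i n) + 1) / (sqrt (real n) + c))" for c n
  have B: "B c \<longlonglongrightarrow> W x" for c
  proof -
    have "B c \<longlonglongrightarrow> 1 * W x"
      unfolding B_def
      by (intro tendsto_mult sqrt_shift_ratio isCont_tendsto_compose[OF W_cont[OF assms]] grid_point_tendsto)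
        (use assms in simp)
    then show ?thesis by simp
  qed
  show ?thesis
  proof (rule tendsto_sandwich[OF _ _ B[of "- L"] B[of L]])
    show "\<forall>\<^sub>F n in sequentially. B (- L) n \<le> real (p n (?i n)) / sqrt (real n)"
      using ev
    proof eventually_elim
      case (elim n)
      then have "(sqrt (real n) - L) * W ((real (?i n) + 1) / (sqrt (real n) - L)) \<le> real (p n (?i n))"
        by simp
      then show ?case using divide_right_mono[of _ _ "sqrt (real n)"] by (fastforce simp: B_def)
    qed
    show "\<forall>\<^sub>F n in sequentially. real (p n (?i n)) / sqrt (real n) \<le> B L n"
      using ev
    proof eventually_elim
      case (elim n)
      then have "real (p n (?i n)) \<le> (sqrt (real n) + L) * W ((real (?i n) + 1) / (sqrt (real n) + L))"
        by simp
      then show ?case using divide_right_mono[of _ _ "sqrt (real n)"] by (fastforce simp: B_def)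
    qed
  qed
qed

text \<open>The two strict inequalities say that \<open>W\<close> passes through the level \<open>y\<close> at \<open>X\<close> without a plateau.\<close>

lemma column_tendsto:
  assumes j: "(\<lambda>n. real (j n) / sqrt (real n)) \<longlonglongrightarrow> y" and X: "X \<ge> 0"
    and above: "\<And>x. x > X \<Longrightarrow> W x < y" and below: "\<And>x. 0 \<le> x \<Longrightarrow> x < X \<Longrightarrow> W x > y"
  shows "(\<lambda>n. real (conjugate (p n) (j n)) / sqrt (real n)) \<longlonglongrightarrow> X"
proof (rule order_tendstoI)
  obtain L where L: "L > 0" and ev: "\<forall>\<^sub>F n in sequentially. sqrt (real n) > L \<and> sqrt (real n) \<ge> 1 \<and>
    (\<forall>i. real (p n i) \<le> (sqrt (real n) + L) * W ((real i + 1) / (sqrt (real n) + L))) \<and>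
    (\<forall>i z. z > real i \<longrightarrow> (sqrt (real n) - L) * W (z / (sqrt (real n) - L)) \<le> real (p n i))"
    by (rule row_bounds)
  {
    fix c assume c: "c < X"
    show "\<forall>\<^sub>F n in sequentially. c < real (conjugate (p n) (j n)) / sqrt (real n)"
    proof (cases "c < 0")
      case True
      then show ?thesis by (intro always_eventually allI) (simp add: less_le_trans)
    next
      case False
      \<comment> \<open>Two intermediate points: \<open>u\<close> selects the row to test, and
        \<open>v\<close> absorbs the rounding and dilation in its rescaled position.\<close>
      obtain u where u: "c < u" "u < X" using c dense by blast
      obtain v where v: "u < v" "v < X" using u dense by blast
      let ?i = "\<lambda>n. nat \<lfloor>u * sqrt (real n)\<rfloor>"
      have "\<forall>\<^sub>F n in sequentially. (real (?i n) + 1) / (sqrt (real n) + - L) < v"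
        by (rule order_tendstoD[OF grid_point_tendsto]) (use False u v in auto)
      moreover have "(\<lambda>n. (sqrt (real n) + - L) / sqrt (real n) * W v - real (j n) / sqrt (real n)) \<longlonglongrightarrow> 1 * W v - y"
        by (intro tendsto_diff tendsto_mult sqrt_shift_ratio tendsto_const j)
      then have "\<forall>\<^sub>F n in sequentially. 0 < (sqrt (real n) + - L) / sqrt (real n) * W v - real (j n) / sqrt (real n)"
        by (rule order_tendstoD) (use below[of v] False u v in auto)
      ultimately show ?thesis using ev
      proof eventually_elim
        case (elim n)
        have pos: "sqrt (real n) > 0" "sqrt (real n) - L > 0" using elim by auto
        have "real (j n) < (sqrt (real n) - L) * W v" using elim pos by (simp add: field_simps)
        also have "\<dots> \<le> (sqrt (real n) - L) * W ((real (?i n) + 1) / (sqrt (real n) - L))"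
          using elim pos by (intro mult_left_mono W_anti) auto
        also have "\<dots> \<le> real (p n (?i n))" using elim by simp
        finally have "?i n < conjugate (p n) (j n)" using less_conjugate_iff[OF part] by simp
        then have "u * sqrt (real n) < real (conjugate (p n) (j n))" by linarith
        then have "u < real (conjugate (p n) (j n)) / sqrt (real n)" using pos by (simp add: field_simps)
        then show ?case using u by simp
      qed
    qed
  next
    fix c assume c: "X < c"
    obtain u where u: "X < u" "u < c" using c dense by blast
    obtain v where v: "X < v" "v < u" using u dense by blast
    let ?i = "\<lambda>n. nat \<lfloor>u * sqrt (real n)\<rfloor>"
    have "\<forall>\<^sub>F n in sequentially. v < (real (?i n) + 1) / (sqrt (real n) + L)"
      by (rule order_tendstoD[OF grid_point_tendsto]) (use X u v in auto)
    moreover have "(\<lambda>n. (sqrt (real n) + L) / sqrt (real n) * W v - real (j n) / sqrt (real n)) \<longlonglongrightarrow> 1 * W v - y"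
      by (intro tendsto_diff tendsto_mult sqrt_shift_ratio tendsto_const j)
    then have "\<forall>\<^sub>F n in sequentially. (sqrt (real n) + L) / sqrt (real n) * W v - real (j n) / sqrt (real n) < 0"
      by (rule order_tendstoD) (use above[of v] v in auto)
    ultimately show "\<forall>\<^sub>F n in sequentially. real (conjugate (p n) (j n)) / sqrt (real n) < c" using ev
    proof eventually_elim
      case (elim n)
      have pos: "sqrt (real n) > 0" "sqrt (real n) + L > 0" using elim L by auto
      have "real (p n (?i n)) \<le> (sqrt (real n) + L) * W ((real (?i n) + 1) / (sqrt (real n) + L))"
        using elim by simp
      also have "\<dots> \<le> (sqrt (real n) + L) * W v"
        using elim pos X v by (intro mult_left_mono W_anti) auto
      also have "\<dots> < real (j n)"
      proof -
        have "((sqrt (real n) + L) * W v) / sqrt (real n) < real (j n) / sqrt (real n)" using elim by simp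
        then show ?thesis using pos(1) by (simp only: divide_less_cancel)
      qed
      finally have "conjugate (p n) (j n) \<le> ?i n" using less_conjugate_iff[OF part, of "?i n" n "j n"] by linarith
      moreover have "real (?i n) \<le> u * sqrt (real n)" using u X pos by simp
      ultimately have "real (conjugate (p n) (j n)) \<le> u * sqrt (real n)" by linarith
      then have "real (conjugate (p n) (j n)) / sqrt (real n) \<le> u" using pos by (simp add: field_simps)
      then show ?case using u by simp
    qed
  }
qed

text \<open>Eventually \<open>L < sqrt n\<close>, so the dilation factor is at most
  \<open>2 * sqrt n\<close>. After rescaling, all cells lie in one fixed rectangle.\<close>

lemma diameter_bound:
  "\<forall>\<^sub>F n in sequentially. \<forall>i. real (p n i) \<le> 2 * b * sqrt (real n) \<and>
     real (conjugate (p n) i) \<le> 2 * a * sqrt (real n)"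
proof -
  obtain L where L: "L > 0" and ev: "\<forall>\<^sub>F n in sequentially. sqrt (real n) > L \<and> sqrt (real n) \<ge> 1 \<and>
    (\<forall>i. real (p n i) \<le> (sqrt (real n) + L) * W ((real i + 1) / (sqrt (real n) + L))) \<and>
    (\<forall>i z. z > real i \<longrightarrow> (sqrt (real n) - L) * W (z / (sqrt (real n) - L)) \<le> real (p n i))"
    by (rule row_bounds)
  from ev show ?thesis
  proof eventually_elim
    case (elim n)
    define s where "s = sqrt (real n) + L"
    have s: "s > 0" "s \<le> 2 * sqrt (real n)" using elim L by (auto simp: s_def)
    have row: "real (p n i) \<le> s * W ((real i + 1) / s)" for i using elim by (simp add: s_def)
    show ?case
    proof (intro allI conjI)
      fix i
      have "real (p n i) \<le> s * b" using row[of i] W_le s by (meson mult_left_mono less_imp_le order_trans)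
      also have "\<dots> \<le> 2 * sqrt (real n) * b" using s b_nonneg by (intro mult_right_mono)
      finally show "real (p n i) \<le> 2 * b * sqrt (real n)" by (simp add: mult_ac)
      show "real (conjugate (p n) i) \<le> 2 * a * sqrt (real n)"
      proof (cases "conjugate (p n) i")
        case 0
        then show ?thesis using a_pos by simp
      next
        case (Suc l)
        then have "i < p n l" using less_conjugate_iff[OF part, of l n i] by simp
        then have "s * W ((real l + 1) / s) > 0" using row[of l] by linarith
        then have "W ((real l + 1) / s) \<noteq> 0" using s by auto
        then have "(real l + 1) / s \<le> a" by (auto simp: W_def split: if_splits)
        then have "real l + 1 \<le> a * s" using s by (simp add: field_simps)
        also have "\<dots> \<le> a * (2 * sqrt (real n))" using s a_pos by simp
        finally show ?thesis using Suc by simp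
      qed
    qed
  qed
qed

end

section \<open>Convergence of the hook sums\<close>

text \<open>\<open>S n\<close> will be the sum of ln (h / sqrt n), so that the hook product has
  logarithm \<open>S n + 1/2 * m n * ln n\<close>. With \<open>q = m / n\<close> and the Stirling
  error \<open>B\<close>, the remainder divided by n splits into five null sequences; the one
  containing \<open>(m - n) * ln n / n\<close> draws on the rate O(sqrt n).\<close>

lemma stirling_remainder:
  fixes m :: "nat \<Rightarrow> nat" and S :: "nat \<Rightarrow> real"
  assumes m: "\<forall>\<^sub>F n in sequentially. \<bar>real (m n) - real n\<bar> \<le> K * sqrt (real n)"
    and S: "(\<lambda>n. S n / real n) \<longlonglongrightarrow> c"
  shows "(\<lambda>n. ln (fact (m n)) - S n - 1/2 * real (m n) * ln (real n) - 1/2 * real n * ln (real n)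
      + (1 + c) * real n) \<in> o(\<lambda>n. real n)"
proof -
  define q where "q n = real (m n) / real n" for n
  have ln1: "(\<lambda>n. ln (real n) / real n) \<longlonglongrightarrow> 0"
    by (rule lim_ln_over_n)
  have "(\<lambda>n. ln (real n) / real n powr (1/2)) \<longlonglongrightarrow> 0"
    using lim_ln_over_power[of "1/2"] by simp
  then have ln2: "(\<lambda>n. ln (real n) / sqrt (real n)) \<longlonglongrightarrow> 0" by (simp add: powr_half_sqrt)
  have d: "(\<lambda>n. (real (m n) - real n) / real n) \<longlonglongrightarrow> 0"
  proof (rule Lim_null_comparison[OF _ inverse_sqrt_tendsto[of K]])
    show "\<forall>\<^sub>F n in sequentially. norm ((real (m n) - real n) / real n) \<le> K / sqrt (real n)"
      using m eventually_gt_at_top[of 0]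
    proof eventually_elim
      case (elim n)
      then have "\<bar>real (m n) - real n\<bar> / real n \<le> K * sqrt (real n) / real n"
        by (intro divide_right_mono) auto
      also have "\<dots> = K / sqrt (real n)" using elim by (simp add: field_simps)
      finally show ?case by simp
    qed
  qed
  have "(\<lambda>n. (real (m n) - real n) / real n + 1) \<longlonglongrightarrow> 0 + 1" by (intro tendsto_add d tendsto_const)
  moreover have "\<forall>\<^sub>F n in sequentially. (real (m n) - real n) / real n + 1 = q n"
    using eventually_gt_at_top[of 0] by eventually_elim (simp add: q_def field_simps)
  ultimately have q: "q \<longlonglongrightarrow> 1" using Lim_transform_eventually by force
  have lnq: "(\<lambda>n. ln (q n)) \<longlonglongrightarrow> 0" using tendsto_ln[OF q] by simp
  have qpos: "\<forall>\<^sub>F n in sequentially. q n > 0" using order_tendstoD(1)[OF q, of 0] by simp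
  have d2: "(\<lambda>n. (real (m n) - real n) * ln (real n) / real n) \<longlonglongrightarrow> 0"
  proof (rule Lim_null_comparison)
    show "(\<lambda>n. K * (ln (real n) / sqrt (real n))) \<longlonglongrightarrow> 0" using tendsto_mult_right_zero[OF ln2] .
    show "\<forall>\<^sub>F n in sequentially. norm ((real (m n) - real n) * ln (real n) / real n)
        \<le> K * (ln (real n) / sqrt (real n))"
      using m eventually_gt_at_top[of 0]
    proof eventually_elim
      case (elim n)
      then have ln0: "ln (real n) \<ge> 0" by simp
      have "\<bar>real (m n) - real n\<bar> * ln (real n) / real n \<le> K * sqrt (real n) * ln (real n) / real n"
        using elim ln0 by (intro divide_right_mono mult_right_mono) auto
      also have "\<dots> = K * (ln (real n) / sqrt (real n))" using elim by (simp add: field_simps)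
      finally show ?case using ln0 by (simp add: abs_mult)
    qed
  qed
  define B where "B n = ln (fact (m n)) - (real (m n) * ln (real (m n)) - real (m n))" for n
  have B: "(\<lambda>n. B n / real n) \<longlonglongrightarrow> 0"
  proof (rule Lim_null_comparison)
    have "(\<lambda>n. ln (q n) * (1 / real n) + ln (real n) / real n + 1 / real n) \<longlonglongrightarrow> 0 * 0 + 0 + 0"
      by (intro tendsto_add tendsto_mult lnq ln1 lim_1_over_n)
    then show "(\<lambda>n. ln (q n) * (1 / real n) + ln (real n) / real n + 1 / real n) \<longlonglongrightarrow> 0" by simp
    show "\<forall>\<^sub>F n in sequentially. norm (B n / real n) \<le> ln (q n) * (1 / real n) + ln (real n) / real n + 1 / real n"
      using qpos eventually_gt_at_top[of 0]
    proof eventually_elim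
      case (elim n)
      then have m1: "m n \<ge> 1" by (cases "m n") (auto simp: q_def)
      have "B n \<ge> 0" "B n \<le> ln (real (m n)) + 1"
        using ln_fact_lower[OF m1] ln_fact_upper[OF m1] by (auto simp: B_def)
      moreover have "ln (real (m n)) = ln (q n) + ln (real n)"
        using elim m1 by (simp add: q_def ln_div)
      ultimately have "\<bar>B n\<bar> / real n \<le> (ln (q n) + ln (real n) + 1) / real n"
        by (intro divide_right_mono) auto
      then show ?case by (simp add: add_divide_distrib)
    qed
  qed
  have "(\<lambda>n. B n / real n + q n * ln (q n) + 1/2 * ((real (m n) - real n) * ln (real n) / real n)
      - (real (m n) - real n) / real n - (S n / real n - c)) \<longlonglongrightarrow> 0 + 1 * 0 + 1/2 * 0 - 0 - (c - c)"
    by (intro tendsto_add tendsto_diff tendsto_mult B q lnq d2 d S tendsto_const)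
  moreover have "\<forall>\<^sub>F n in sequentially. B n / real n + q n * ln (q n)
      + 1/2 * ((real (m n) - real n) * ln (real n) / real n)
      - (real (m n) - real n) / real n - (S n / real n - c) =
     (ln (fact (m n)) - S n - 1/2 * real (m n) * ln (real n) - 1/2 * real n * ln (real n)
      + (1 + c) * real n) / real n"
    using qpos eventually_gt_at_top[of 0]
  proof eventually_elim
    case (elim n)
    then have m1: "m n \<ge> 1" by (cases "m n") (auto simp: q_def)
    have lnm: "ln (q n) = ln (real (m n)) - ln (real n)" using elim m1 by (simp add: q_def ln_div)
    show ?case unfolding lnm B_def unfolding q_def using elim by (simp add: field_simps)
  qed
  ultimately have lim: "(\<lambda>n. (ln (fact (m n)) - S n - 1/2 * real (m n) * ln (real n) - 1/2 * real n * ln (real n)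
      + (1 + c) * real n) / real n) \<longlonglongrightarrow> 0"
    using Lim_transform_eventually by force
  show ?thesis
    by (rule smalloI_tendsto[OF lim]) (use eventually_gt_at_top[of 0] in \<open>auto elim: eventually_mono\<close>)
qed

section \<open>The limit region and its logarithmic integral in sheared coordinates\<close>

locale stable_skew_shape =
  upper: stable_shape a b \<omega> lam + lower: stable_shape a b \<pi> \<mu>
  for a b :: real and \<omega> \<pi> :: "real \<Rightarrow> real" and lam \<mu> :: "nat \<Rightarrow> nat \<Rightarrow> nat" +
  assumes pi_le: "\<And>x. x \<in> {0..a} \<Longrightarrow> \<pi> x \<le> \<omega> x"
    and skew: "\<And>n. skew_shape (lam n) (\<mu> n)"
begin

lemma W_le_W: "lower.W x \<le> upper.W x"
  using pi_le by (simp add: upper.W_def lower.W_def)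

lemma skew_region_eq:
  "skew_region a \<omega> \<pi> = {z. 0 \<le> fst z \<and> fst z \<le> a \<and> lower.W (fst z) \<le> snd z \<and> snd z \<le> upper.W (fst z)}"
  by (auto simp: skew_region_def upper.W_def lower.W_def)

lemma skew_region_borel [measurable]: "skew_region a \<omega> \<pi> \<in> sets borel"
proof -
  have "{z \<in> space (borel :: (real \<times> real) measure).
      0 \<le> fst z \<and> fst z \<le> a \<and> lower.W (fst z) \<le> snd z \<and> snd z \<le> upper.W (fst z)} \<in> sets borel"
    unfolding borel_prod[symmetric] by measurable
  then show ?thesis by (simp add: skew_region_eq)
qed

lemma area_eq: "area (skew_region a \<omega> \<pi>) = integral\<^sup>L lborel upper.W - integral\<^sup>L lborel lower.W"
proof -
  let ?C = "skew_region a \<omega> \<pi>"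
  have C: "?C \<in> sets (lborel \<Otimes>\<^sub>M lborel)" unfolding sets_lborel_pair by measurable
  have int: "integrable lborel (\<lambda>x. upper.W x - lower.W x)"
    using upper.W_integrable lower.W_integrable by simp
  have "emeasure (lborel \<Otimes>\<^sub>M lborel) ?C = (\<integral>\<^sup>+x. emeasure lborel (Pair x -` ?C) \<partial>lborel)"
    by (rule lborel.emeasure_pair_measure_alt[OF C])
  also have "\<dots> = (\<integral>\<^sup>+x. ennreal (upper.W x - lower.W x) \<partial>lborel)"
  proof (rule nn_integral_cong)
    fix x :: real
    show "emeasure lborel (Pair x -` ?C) = ennreal (upper.W x - lower.W x)"
    proof (cases "0 \<le> x \<and> x \<le> a")
      case True
      then have "Pair x -` ?C = {lower.W x..upper.W x}" by (auto simp: skew_region_eq)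
      then show ?thesis using W_le_W by simp
    next
      case False
      then have "Pair x -` ?C = {}" by (auto simp: skew_region_eq)
      then show ?thesis using False by (auto simp: upper.W_def lower.W_def)
    qed
  qed
  also have "\<dots> = ennreal (\<integral>x. upper.W x - lower.W x \<partial>lborel)"
    by (rule nn_integral_eq_integral[OF int]) (simp add: W_le_W)
  finally have "emeasure lborel ?C = ennreal (\<integral>x. upper.W x - lower.W x \<partial>lborel)"
    by (simp only: lborel_prod)
  moreover have "0 \<le> (\<integral>x. upper.W x - lower.W x \<partial>lborel)"
    by (rule integral_nonneg_AE) (simp add: W_le_W)
  ultimately show ?thesis
    using upper.W_integrable lower.W_integrable by (simp add: area_def measure_def)
qed

text \<open>Above \<open>\<omega> 0\<close> the set in \<^const>\<open>shape_inverse\<close> is empty and its supremum unspecified; the value 0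
  keeps the function monotone.\<close>

definition Inv :: "real \<Rightarrow> real" where
  "Inv y = (if y \<le> \<omega> 0 then shape_inverse a \<omega> y else 0)"

lemma level_set: 
  assumes "y \<le> \<omega> 0"
  shows "0 \<in> {x \<in> {0..a}. \<omega> x \<ge> y}" "bdd_above {x \<in> {0..a}. \<omega> x \<ge> y}"
  using assms upper.a_pos by (auto intro: bdd_aboveI[of _ a])

text \<open>Monotonicity makes the generalized inverse Borel measurable.\<close>

lemma Inv_antimono: "y \<le> y' \<Longrightarrow> Inv y' \<le> Inv y"
proof -
  assume le: "y \<le> y'"
  show ?thesis
  proof (cases "y' \<le> \<omega> 0")
    case True
    have "shape_inverse a \<omega> y' \<le> shape_inverse a \<omega> y"
      unfolding shape_inverse_def
      by (rule cSup_subset_mono) (use level_set[of y] level_set[of y'] True le in auto)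
    then show ?thesis using True le by (simp add: Inv_def)
  next
    case False
    have "0 \<le> shape_inverse a \<omega> y" if "y \<le> \<omega> 0"
      unfolding shape_inverse_def using level_set[OF that] by (rule cSup_upper)
    then show ?thesis using False by (simp add: Inv_def)
  qed
qed

lemma Inv_borel [measurable]: "Inv \<in> borel_measurable borel"
proof -
  have "(\<lambda>y. - Inv y) \<in> borel_measurable borel"
    by (rule borel_measurable_mono) (simp add: mono_def Inv_antimono)
  then have "(\<lambda>y. - (- Inv y)) \<in> borel_measurable borel" by (rule borel_measurable_uminus)
  then show ?thesis by simp
qed

text \<open>Logarithm of the hook function in sheared coordinates: \<open>t\<close> is the depth
  below the outer boundary, so the height is \<open>upper.W x - t\<close> and the first summand of
  the hook is \<open>t\<close>.\<close>

definition limit_fn :: "real \<times> real \<Rightarrow> real" where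
  "limit_fn = (\<lambda>(x, t). if 0 \<le> x \<and> x \<le> a \<and> 0 \<le> t \<and> t \<le> upper.W x - lower.W x
     then ln (t + Inv (upper.W x - t) - x) else 0)"

lemma limit_fn_borel: "limit_fn \<in> borel_measurable lborel"
proof -
  have "limit_fn \<in> borel_measurable (borel \<Otimes>\<^sub>M borel)" unfolding limit_fn_def by measurable
  then show ?thesis by (simp add: borel_prod)
qed

lemma c_const_eq: "c_const a \<omega> \<pi> = integral\<^sup>L lborel limit_fn"
proof -
  let ?T = "\<lambda>(x, t). (x, upper.W x - t)"
  define g where "g = (\<lambda>(x, y). indicator (skew_region a \<omega> \<pi>) (x, y) * ln (upper.W x - y + (Inv y - x)))"
  have "g \<in> borel_measurable (borel \<Otimes>\<^sub>M borel)"
  proof -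
    have [measurable]: "skew_region a \<omega> \<pi> \<in> sets (borel \<Otimes>\<^sub>M borel)"
      by (subst borel_prod) (rule skew_region_borel)
    show ?thesis unfolding g_def by measurable
  qed
  then have g: "g \<in> borel_measurable lborel" by (simp add: borel_prod)
  have T: "?T \<in> measurable lborel (lborel :: (real \<times> real) measure)"
  proof -
    have "?T \<in> measurable (borel \<Otimes>\<^sub>M borel) (borel \<Otimes>\<^sub>M borel)" by measurable
    then show ?thesis by (simp add: borel_prod)
  qed
  have "indicator (skew_region a \<omega> \<pi>) z *\<^sub>R ln (hook_function a \<omega> z) = g z" for z
  proof (cases "z \<in> skew_region a \<omega> \<pi>")
    case True
    obtain x y where z: "z = (x, y)" by (cases z)
    have x: "0 \<le> x" "x \<le> a" "y \<le> \<omega> x" using True z by (auto simp: skew_region_def)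
    then have "\<omega> x \<le> \<omega> 0" using upper.W_anti[of 0 x] upper.a_pos by (simp add: upper.W_def)
    then show ?thesis using True x by (simp add: z g_def hook_function_def Inv_def upper.W_def)
  next
    case False
    then show ?thesis by (cases z) (simp add: g_def)
  qed
  then have "c_const a \<omega> \<pi> = integral\<^sup>L lborel g"
    by (simp add: c_const_def set_lebesgue_integral_def)
  also have "\<dots> = integral\<^sup>L (distr lborel lborel ?T) g" by (simp only: shear_distr[OF upper.W_borel])
  also have "\<dots> = (\<integral>z. g (?T z) \<partial>lborel)" by (rule integral_distr[OF T g])
  also have "\<dots> = integral\<^sup>L lborel limit_fn"
    by (rule Bochner_Integration.integral_cong)
      (auto simp: g_def limit_fn_def skew_region_eq indicator_def algebra_simps)
  finally show ?thesis .
qed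

text \<open>A cell is addressed by its row \<open>i\<close> and its distance \<open>d\<close> from the last cell of that row.\<close>

definition cells :: "nat \<Rightarrow> (nat \<times> nat) set" where
  "cells n = {(i, d). d < lam n i - \<mu> n i}"

definition weight :: "nat \<Rightarrow> nat \<times> nat \<Rightarrow> real" where
  "weight n = (\<lambda>(i, d). ln (real (hook (lam n) (i, lam n i - 1 - d)) / sqrt (real n)))"

definition approx :: "nat \<Rightarrow> real \<times> real \<Rightarrow> real" where
  "approx n z = (\<Sum>c\<in>cells n. weight n c * indicator (grid (sqrt (real n)) (fst c) \<times> grid (sqrt (real n)) (snd c)) z)"

section \<open>Hook sums as integrals of step functions\<close>

lemma finite_skew: "finite (skew_cells (lam n) (\<mu> n))"
  using partition_imp_bounded[OF upper.part[of n]] finite_skew_cells by blast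

lemma cells_bij:
  "bij_betw (\<lambda>(i, d). (i, lam n i - 1 - d)) (cells n) (skew_cells (lam n) (\<mu> n))"
  by (rule bij_betw_byWitness[where f' = "\<lambda>(i, j). (i, lam n i - 1 - j)"])
    (auto simp: cells_def skew_cells_iff)

lemma finite_cells: "finite (cells n)"
  using bij_betw_finite[OF cells_bij] finite_skew by blast

lemma sum_weight:
  "(\<Sum>c\<in>cells n. weight n c) = (\<Sum>c\<in>skew_cells (lam n) (\<mu> n). ln (real (hook (lam n) c) / sqrt (real n)))"
proof -
  have "(\<Sum>c\<in>cells n. weight n c) =
      (\<Sum>c\<in>cells n. ln (real (hook (lam n) ((\<lambda>(i, d). (i, lam n i - 1 - d)) c)) / sqrt (real n)))"
    by (rule sum.cong) (auto simp: weight_def)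
  also have "\<dots> = (\<Sum>c\<in>skew_cells (lam n) (\<mu> n). ln (real (hook (lam n) c) / sqrt (real n)))"
    by (rule sum.reindex_bij_betw[OF cells_bij])
  finally show ?thesis .
qed

lemma approx_eq:
  assumes "n > 0"
  shows "approx n (x, t) = (if x \<ge> 0 \<and> t \<ge> 0 \<and> (nat \<lfloor>x * sqrt (real n)\<rfloor>, nat \<lfloor>t * sqrt (real n)\<rfloor>) \<in> cells n
    then weight n (nat \<lfloor>x * sqrt (real n)\<rfloor>, nat \<lfloor>t * sqrt (real n)\<rfloor>) else 0)"
proof -
  have s: "sqrt (real n) > 0" using assms by simp
  have "approx n (x, t) = (\<Sum>c\<in>cells n. if c = (nat \<lfloor>x * sqrt (real n)\<rfloor>, nat \<lfloor>t * sqrt (real n)\<rfloor>)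
      then (if x \<ge> 0 \<and> t \<ge> 0 then weight n c else 0) else 0)"
    unfolding approx_def
    by (rule sum.cong) (auto simp: indicator_def grid_iff[OF s] prod_eq_iff)
  also have "\<dots> = (if (nat \<lfloor>x * sqrt (real n)\<rfloor>, nat \<lfloor>t * sqrt (real n)\<rfloor>) \<in> cells n
      then (if x \<ge> 0 \<and> t \<ge> 0 then weight n (nat \<lfloor>x * sqrt (real n)\<rfloor>, nat \<lfloor>t * sqrt (real n)\<rfloor>) else 0) else 0)"
    by (simp add: sum.delta finite_cells)
  finally show ?thesis by auto
qed

lemma approx_integral:
  assumes "n > 0"
  shows "approx n \<in> borel_measurable lborel"
    and "integral\<^sup>L lborel (approx n) = (\<Sum>c\<in>cells n. weight n c) / real n"
proof -
  have "has_bochner_integral lborel (approx n) ((\<Sum>c\<in>cells n. weight n c) / (sqrt (real n))\<^sup>2)"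
    unfolding approx_def by (rule integral_grid_sum2[OF _ finite_cells]) (use assms in simp)
  then have h: "has_bochner_integral lborel (approx n) ((\<Sum>c\<in>cells n. weight n c) / real n)" by simp
  show "approx n \<in> borel_measurable lborel" using h by (rule borel_measurable_has_bochner_integral)
  show "integral\<^sup>L lborel (approx n) = (\<Sum>c\<in>cells n. weight n c) / real n"
    using h by (rule has_bochner_integral_integral_eq)
qed

text \<open>Arm \<open>d\<close>, leg and the cell itself; the second claim makes the hook at least
  \<open>d + 1\<close>, the source of the logarithmic bound.\<close>

lemma hook_cell:
  assumes "(i, d) \<in> cells n"
  shows "real (hook (lam n) (i, lam n i - 1 - d)) = real d + real (conjugate (lam n) (lam n i - 1 - d)) - real i"
    and "i < conjugate (lam n) (lam n i - 1 - d)"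
proof -
  have d: "d < lam n i" using assms by (simp add: cells_def)
  have "(i, lam n i - 1 - d) \<in> diagram (lam n)" using d by (auto simp: diagram_def)
  from hook_eq(1)[OF upper.part this]
  show "real (hook (lam n) (i, lam n i - 1 - d)) = real d + real (conjugate (lam n) (lam n i - 1 - d)) - real i"
    using d by (simp add: of_nat_diff)
  show "i < conjugate (lam n) (lam n i - 1 - d)" using less_conjugate_iff[OF upper.part] d by simp
qed

text \<open>The scaled hook lies between \<open>t\<close> and \<open>2 * a + 2 * b\<close>, so its
  logarithm is controlled by those of the two ends. The line \<open>t = 0\<close> is left out
  because the convention \<open>ln 0 = 0\<close> would invalidate the comparison.\<close>

lemma approx_bound:
  "\<forall>\<^sub>F n in sequentially. \<forall>z. snd z \<noteq> 0 \<longrightarrow> norm (approx n z)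
     \<le> indicator ({0..2 * a} \<times> {0..2 * b}) z * (\<bar>ln (snd z)\<bar> + \<bar>ln (2 * a + 2 * b)\<bar>)"
  using upper.diameter_bound eventually_gt_at_top[of 0]
proof eventually_elim
  case (elim n)
  show ?case
  proof (intro allI impI)
    fix z :: "real \<times> real" assume "snd z \<noteq> 0"
    then obtain x t where z: "z = (x, t)" "t \<noteq> 0" by (cases z) auto
    let ?i = "nat \<lfloor>x * sqrt (real n)\<rfloor>" and ?d = "nat \<lfloor>t * sqrt (real n)\<rfloor>"
    show "norm (approx n z)
     \<le> indicator ({0..2 * a} \<times> {0..2 * b}) z * (\<bar>ln (snd z)\<bar> + \<bar>ln (2 * a + 2 * b)\<bar>)"
    proof (cases "x \<ge> 0 \<and> t \<ge> 0 \<and> (?i, ?d) \<in> cells n")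
      case False
      have "n > 0" using elim by simp
      then have "approx n z = 0" by (simp only: z approx_eq False if_False)
      then show ?thesis by simp
    next
      case True
      let ?j = "lam n ?i - 1 - ?d"
      let ?h = "real (hook (lam n) (?i, ?j))"
      have s: "sqrt (real n) > 0" using elim by simp
      note h = hook_cell[of ?i ?d n]
      have h: "?h = real ?d + real (conjugate (lam n) ?j) - real ?i" "?i < conjugate (lam n) ?j"
        using h True by blast+
      have "?d < lam n ?i - \<mu> n ?i" using True by (simp add: cells_def)
      then have d: "?d < lam n ?i" by (rule less_le_trans) simp
      have lamb: "real (lam n ?i) \<le> 2 * b * sqrt (real n)" and conjb: "real (conjugate (lam n) ?j) \<le> 2 * a * sqrt (real n)"
        using elim by blast+
      have xi: "x * sqrt (real n) \<le> real ?i + 1" and td: "t * sqrt (real n) \<le> real ?d + 1"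
        using True s by linarith+
      have "x * sqrt (real n) \<le> 2 * a * sqrt (real n)" using xi h(2) conjb by linarith
      then have x: "x \<le> 2 * a" using s by simp
      have "t * sqrt (real n) \<le> 2 * b * sqrt (real n)" using td d lamb by linarith
      then have t: "t \<le> 2 * b" using s by simp
      have t0: "t > 0" using z(2) True by simp
      have "t * sqrt (real n) \<le> ?h" using td h by linarith
      then have low: "t \<le> ?h / sqrt (real n)" using s by (simp add: field_simps)
      have "?h \<le> 2 * a * sqrt (real n) + 2 * b * sqrt (real n)" using h(1) d lamb conjb by linarith
      then have up: "?h / sqrt (real n) \<le> 2 * a + 2 * b" using s by (simp add: field_simps)
      have "ln t \<le> ln (?h / sqrt (real n))" using low t0 by simp
      moreover have "ln (?h / sqrt (real n)) \<le> ln (2 * a + 2 * b)" using low up t0 by simp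
      ultimately have "\<bar>ln (?h / sqrt (real n))\<bar> \<le> \<bar>ln t\<bar> + \<bar>ln (2 * a + 2 * b)\<bar>" by linarith
      moreover have "approx n z = ln (?h / sqrt (real n))"
        using True elim by (simp add: z approx_eq weight_def)
      ultimately show ?thesis using x t True by (simp add: z)
    qed
  qed
qed

lemma approx_tendsto:
  assumes x: "x \<noteq> 0" "x \<noteq> a" and t: "t \<noteq> 0" "t \<noteq> upper.W x - lower.W x"
    and good: "upper.W x - t \<notin> \<omega> ` (\<rat> \<inter> {0..a})"
  shows "(\<lambda>n. approx n (x, t)) \<longlonglongrightarrow> limit_fn (x, t)"
proof -
  let ?i = "\<lambda>n. nat \<lfloor>x * sqrt (real n)\<rfloor>" and ?d = "\<lambda>n. nat \<lfloor>t * sqrt (real n)\<rfloor>"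
  have pos: "\<forall>\<^sub>F n::nat in sequentially. n > 0" by (rule eventually_gt_at_top)
  \<comment> \<open>Outside the quadrant, past the inner boundary, and inside the region.\<close>
  consider "x < 0 \<or> t < 0" | "x > 0" "t > 0" "t > upper.W x - lower.W x"
    | "x > 0" "t > 0" "t < upper.W x - lower.W x" using x t by linarith
  then show ?thesis
  proof cases
    case 1
    then have "limit_fn (x, t) = 0" by (auto simp: limit_fn_def)
    moreover have "\<forall>\<^sub>F n in sequentially. approx n (x, t) = 0"
      using pos by eventually_elim (use 1 in \<open>auto simp: approx_eq\<close>)
    ultimately show ?thesis by (simp add: tendsto_eventually)
  next
    case 2
    have "(\<lambda>n. real (lam n (?i n)) / sqrt (real n) - real (\<mu> n (?i n)) / sqrt (real n) - real (?d n) / sqrt (real n))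
        \<longlonglongrightarrow> upper.W x - lower.W x - t"
      using 2 x by (intro tendsto_diff upper.row_tendsto lower.row_tendsto nat_floor_sqrt_tendsto) auto
    then have "\<forall>\<^sub>F n in sequentially. real (lam n (?i n)) / sqrt (real n) - real (\<mu> n (?i n)) / sqrt (real n)
        - real (?d n) / sqrt (real n) < 0"
      by (rule order_tendstoD) (use 2 in simp)
    then have "\<forall>\<^sub>F n in sequentially. approx n (x, t) = 0"
      using pos
    proof eventually_elim
      case (elim n)
      then have "(real (lam n (?i n)) - real (\<mu> n (?i n)) - real (?d n)) / sqrt (real n) < 0"
        by (simp add: diff_divide_distrib)
      then have "real (lam n (?i n)) - real (\<mu> n (?i n)) - real (?d n) < 0"
        using elim by (simp add: divide_less_0_iff)
      then have "(?i n, ?d n) \<notin> cells n" by (auto simp: cells_def)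
      then show ?case using elim by (simp add: approx_eq)
    qed
    moreover have "limit_fn (x, t) = 0" using 2 by (auto simp: limit_fn_def)
    ultimately show ?thesis by (simp add: tendsto_eventually)
  next
    case 3
    define y where "y = upper.W x - t"
    have y: "y > 0" using 3 lower.W_nonneg[of x] by (simp add: y_def)
    have xa: "x < a"
    proof (rule ccontr)
      assume "\<not> x < a"
      then have "upper.W x = 0" using x by (simp add: upper.W_def)
      then show False using y 3 by (simp add: y_def)
    qed
    have yx: "y \<le> \<omega> x" using 3 xa by (simp add: y_def upper.W_def)
    have y0: "y \<le> \<omega> 0" using yx upper.W_anti[of 0 x] 3 xa by (simp add: upper.W_def)
    let ?A = "{x \<in> {0..a}. \<omega> x \<ge> y}"
    define X where "X = Inv y"
    have X: "X = Sup ?A" using y0 by (simp add: X_def Inv_def shape_inverse_def)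
    have bdd: "bdd_above ?A" using level_set[OF y0] by blast
    \<comment> \<open>Keeps the limit \<open>t + X - x\<close> of the scaled hook at least
      \<open>t > 0\<close>, where \<open>ln\<close> is continuous.\<close>
    have xX: "x \<le> X" unfolding X by (rule cSup_upper) (use 3 xa yx bdd in auto)
    define j where "j n = lam n (?i n) - 1 - ?d n" for n
    have diff: "(\<lambda>n. real (lam n (?i n)) / sqrt (real n) - real (\<mu> n (?i n)) / sqrt (real n) - real (?d n) / sqrt (real n))
        \<longlonglongrightarrow> upper.W x - lower.W x - t"
      using 3 x by (intro tendsto_diff upper.row_tendsto lower.row_tendsto nat_floor_sqrt_tendsto) auto
    then have "\<forall>\<^sub>F n in sequentially. real (lam n (?i n)) / sqrt (real n) - real (\<mu> n (?i n)) / sqrt (real n)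
        - real (?d n) / sqrt (real n) > 0"
      by (rule order_tendstoD) (use 3 in simp)
    then have cell: "\<forall>\<^sub>F n in sequentially. (?i n, ?d n) \<in> cells n"
      using pos
    proof eventually_elim
      case (elim n)
      then have "(real (lam n (?i n)) - real (\<mu> n (?i n)) - real (?d n)) / sqrt (real n) > 0"
        by (simp add: diff_divide_distrib)
      then have "real (lam n (?i n)) - real (\<mu> n (?i n)) - real (?d n) > 0"
        using elim by (simp add: zero_less_divide_iff)
      then show ?case by (simp add: cells_def)
    qed
    have "(\<lambda>n. real (lam n (?i n)) / sqrt (real n) - 1 / sqrt (real n) - real (?d n) / sqrt (real n))
        \<longlonglongrightarrow> upper.W x - 0 - t"
      using 3 x by (intro tendsto_diff upper.row_tendsto inverse_sqrt_tendsto nat_floor_sqrt_tendsto) auto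
    moreover have "\<forall>\<^sub>F n in sequentially. real (lam n (?i n)) / sqrt (real n) - 1 / sqrt (real n)
        - real (?d n) / sqrt (real n) = real (j n) / sqrt (real n)"
      using cell
    proof eventually_elim
      case (elim n)
      then have "?d n + 1 \<le> lam n (?i n)" by (simp add: cells_def)
      then have "real (j n) = real (lam n (?i n)) - 1 - real (?d n)" by (simp add: j_def of_nat_diff)
      then show ?case by (simp add: diff_divide_distrib)
    qed
    ultimately have jlim: "(\<lambda>n. real (j n) / sqrt (real n)) \<longlonglongrightarrow> y"
      using Lim_transform_eventually by (force simp: y_def)
    have col: "(\<lambda>n. real (conjugate (lam n) (j n)) / sqrt (real n)) \<longlonglongrightarrow> X"
    proof (rule upper.column_tendsto[OF jlim])
      show "0 \<le> X" using xX 3 by simp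
      show "upper.W x' < y" if "x' > X" for x'
      proof (rule ccontr)
        assume n: "\<not> upper.W x' < y"
        then have "x' \<in> ?A" using y by (auto simp: upper.W_def split: if_splits)
        then have "x' \<le> X" unfolding X using bdd by (rule cSup_upper)
        then show False using that by simp
      qed
      show "upper.W x' > y" if x': "0 \<le> x'" "x' < X" for x'
      proof -
        \<comment> \<open>At a rational \<open>q\<close> between \<open>x'\<close> and
          \<open>X\<close> the value of \<omega> is at least \<open>y\<close>, and
          \<open>good\<close> excludes equality; this rules out a plateau at height
          \<open>y\<close>.\<close>
        obtain q where q: "q \<in> \<rat>" "x' < q" "q < X" using Rats_dense_in_real x' by blast
        have "\<exists>x''\<in>?A. q < x''"
          using q(3) unfolding X using less_cSup_iff[OF _ bdd] level_set(1)[OF y0] by blast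
        then obtain x'' where x'': "x'' \<in> ?A" "q < x''" by blast
        have q0: "0 \<le> q" "q \<le> a" using q x' x'' by auto
        have "\<omega> x'' \<le> \<omega> q" using upper.W_anti[of q x''] q0 x'' by (simp add: upper.W_def)
        moreover have "y \<noteq> \<omega> q" using good q(1) q0 by (auto simp: y_def)
        ultimately have "\<omega> q > y" using x'' by simp
        moreover have "upper.W q \<le> upper.W x'" using upper.W_anti x' q by simp
        ultimately show ?thesis using q0 by (simp add: upper.W_def)
      qed
    qed
    have "(\<lambda>n. ln (real (?d n) / sqrt (real n) + real (conjugate (lam n) (j n)) / sqrt (real n) - real (?i n) / sqrt (real n)))
        \<longlonglongrightarrow> ln (t + X - x)"
      using 3 xX by (intro tendsto_ln tendsto_diff tendsto_add col nat_floor_sqrt_tendsto) auto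
    moreover have "\<forall>\<^sub>F n in sequentially. ln (real (?d n) / sqrt (real n)
        + real (conjugate (lam n) (j n)) / sqrt (real n) - real (?i n) / sqrt (real n)) = approx n (x, t)"
      using cell pos
    proof eventually_elim
      case (elim n)
      then show ?case using 3 hook_cell(1)[OF elim(1)]
        by (simp add: approx_eq weight_def j_def add_divide_distrib diff_divide_distrib)
    qed
    ultimately have "(\<lambda>n. approx n (x, t)) \<longlonglongrightarrow> ln (t + X - x)"
      using Lim_transform_eventually by force
    moreover have "limit_fn (x, t) = ln (t + X - x)"
      using 3 xa by (simp add: limit_fn_def X_def y_def)
    ultimately show ?thesis by simp
  qed
qed

text \<open>A level at which \<open>\<omega>\<close> has a plateau is attained at a rational point, so there are only countably
  many of them.\<close>

lemma AE_approx_tendsto: "AE z in lborel. (\<lambda>n. approx n z) \<longlonglongrightarrow> limit_fn z"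
proof -
  have count: "countable (\<omega> ` (\<rat> \<inter> {0..a}))" by (intro countable_image countable_Int1 countable_rat)
  have "AE z in lborel. snd z \<noteq> upper.W (fst z) - v" for v
    by (rule AE_lborel_not_graph) measurable
  then have "AE z in lborel. \<forall>v\<in>\<omega> ` (\<rat> \<inter> {0..a}). snd z \<noteq> upper.W (fst z) - v"
    by (subst AE_ball_countable[OF count]) simp
  moreover have "AE z::real \<times> real in lborel. snd z \<noteq> 0" by (rule AE_lborel_not_graph) measurable
  moreover have "AE z in lborel. snd z \<noteq> upper.W (fst z) - lower.W (fst z)"
    by (rule AE_lborel_not_graph) measurable
  ultimately show ?thesis using AE_lborel_fst_neq[of 0] AE_lborel_fst_neq[of a]
  proof eventually_elim
    case (elim z)
    then have "upper.W (fst z) - snd z \<notin> \<omega> ` (\<rat> \<inter> {0..a})" by force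
    then show ?case using approx_tendsto[of "fst z" "snd z"] elim by simp
  qed
qed

lemma hook_sum_tendsto:
  "(\<lambda>n. (\<Sum>c\<in>skew_cells (lam n) (\<mu> n). ln (real (hook (lam n) c) / sqrt (real n))) / real n)
     \<longlonglongrightarrow> c_const a \<omega> \<pi>"
proof -
  obtain n0 where n0: "\<And>n z. n \<ge> n0 \<Longrightarrow> snd z \<noteq> 0 \<Longrightarrow> norm (approx n z)
     \<le> indicator ({0..2 * a} \<times> {0..2 * b}) z * (\<bar>ln (snd z)\<bar> + \<bar>ln (2 * a + 2 * b)\<bar>)"
    using approx_bound unfolding eventually_sequentially by blast
  \<comment> \<open>Dominated convergence wants the bound for every index, hence the shift;
    \<open>Suc\<close> also keeps the index positive.\<close>
  define N where "N = Suc n0"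
  have "(\<lambda>n. integral\<^sup>L lborel (approx (n + N))) \<longlonglongrightarrow> integral\<^sup>L lborel limit_fn"
  proof (rule integral_dominated_convergence)
    show "integrable lborel (\<lambda>z::real \<times> real. indicator ({0..2 * a} \<times> {0..2 * b}) z * (\<bar>ln (snd z)\<bar> + \<bar>ln (2 * a + 2 * b)\<bar>))"
      by (rule integrable_ln_rectangle) (use upper.a_pos upper.b_nonneg in auto)
    show "limit_fn \<in> borel_measurable lborel" by (rule limit_fn_borel)
    show "approx (n + N) \<in> borel_measurable lborel" for n by (rule approx_integral) (simp add: N_def)
    show "AE z in lborel. (\<lambda>n. approx (n + N) z) \<longlonglongrightarrow> limit_fn z"
      using AE_approx_tendsto by eventually_elim (rule LIMSEQ_ignore_initial_segment)
    show "AE z in lborel. norm (approx (n + N) z)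
        \<le> indicator ({0..2 * a} \<times> {0..2 * b}) z * (\<bar>ln (snd z)\<bar> + \<bar>ln (2 * a + 2 * b)\<bar>)" for n
    proof -
      have "AE z::real \<times> real in lborel. snd z \<noteq> 0" by (rule AE_lborel_not_graph) measurable
      then show ?thesis by eventually_elim (rule n0, simp_all add: N_def)
    qed
  qed
  then have "(\<lambda>n. integral\<^sup>L lborel (approx n)) \<longlonglongrightarrow> c_const a \<omega> \<pi>"
    unfolding c_const_eq by (rule LIMSEQ_offset)
  moreover have "\<forall>\<^sub>F n in sequentially. integral\<^sup>L lborel (approx n) =
      (\<Sum>c\<in>skew_cells (lam n) (\<mu> n). ln (real (hook (lam n) c) / sqrt (real n))) / real n"
    using eventually_gt_at_top[of 0] by eventually_elim (simp add: approx_integral sum_weight)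
  ultimately show ?thesis using Lim_transform_eventually by force
qed

lemma card_bound:
  assumes "area (skew_region a \<omega> \<pi>) = 1"
  shows "\<exists>K. \<forall>\<^sub>F n in sequentially. \<bar>real (card (skew_cells (lam n) (\<mu> n))) - real n\<bar> \<le> K * sqrt (real n)"
proof -
  obtain K1 K2 where
    K1: "\<forall>\<^sub>F n in sequentially. \<bar>real (card (diagram (lam n))) - real n * integral\<^sup>L lborel upper.W\<bar> \<le> K1 * sqrt (real n)"
    and K2: "\<forall>\<^sub>F n in sequentially. \<bar>real (card (diagram (\<mu> n))) - real n * integral\<^sup>L lborel lower.W\<bar> \<le> K2 * sqrt (real n)"
    using upper.size_bound lower.size_bound by blast
  have I: "integral\<^sup>L lborel upper.W = integral\<^sup>L lborel lower.W + 1" using assms area_eq by simp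
  have "\<forall>\<^sub>F n in sequentially. \<bar>real (card (skew_cells (lam n) (\<mu> n))) - real n\<bar> \<le> (K1 + K2) * sqrt (real n)"
    using K1 K2
  proof eventually_elim
    case (elim n)
    have sub: "diagram (\<mu> n) \<subseteq> diagram (lam n)" using skew by (simp add: skew_shape_def)
    have "finite (diagram (lam n))" using partition_imp_bounded[OF upper.part[of n]] finite_diagram by blast
    then have "card (skew_cells (lam n) (\<mu> n)) = card (diagram (lam n)) - card (diagram (\<mu> n))"
      "card (diagram (\<mu> n)) \<le> card (diagram (lam n))"
      unfolding skew_cells_def using sub by (auto intro!: card_Diff_subset card_mono finite_subset[OF sub])
    then have "real (card (skew_cells (lam n) (\<mu> n))) = real (card (diagram (lam n))) - real (card (diagram (\<mu> n)))"
      by (simp add: of_nat_diff)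
    then show ?case using elim unfolding I by (simp add: algebra_simps abs_le_iff)
  qed
  then show ?thesis by blast
qed

lemma num_SYT_asymptotics:
  assumes "area (skew_region a \<omega> \<pi>) = 1"
  shows "\<exists>r :: nat \<Rightarrow> real. r \<in> o(\<lambda>n. real n) \<and>
    (\<forall>\<^sub>F n in sequentially.
       - (1 + c_const a \<omega> \<pi>) * real n + r n
         \<le> ln (real (num_SYT (lam n) (\<mu> n))) - 1/2 * real n * ln (real n) \<and>
       ln (real (num_SYT (lam n) (\<mu> n))) - 1/2 * real n * ln (real n)
         \<le> - (1 + c_const a \<omega> \<pi>) * real n + ln (real (num_excited (lam n) (\<mu> n))) + r n)"
proof -
  define m where "m n = card (skew_cells (lam n) (\<mu> n))" for n
  define S where "S n = (\<Sum>c\<in>skew_cells (lam n) (\<mu> n). ln (real (hook (lam n) c) / sqrt (real n)))" for n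
  define H where "H n = (\<Prod>c\<in>skew_cells (lam n) (\<mu> n). real (hook (lam n) c))" for n
  \<comment> \<open>Given \<open>lnH\<close> below, this is exactly the defect of
    \<open>ln (fact (m n)) - ln (H n)\<close> from the claimed main terms. Both inequalities become
    logarithms of \<open>naruse_bounds\<close>, and one remainder serves both.\<close>
  define r where "r n = ln (fact (m n)) - S n - 1/2 * real (m n) * ln (real n) - 1/2 * real n * ln (real n)
      + (1 + c_const a \<omega> \<pi>) * real n" for n
  obtain K where K: "\<forall>\<^sub>F n in sequentially. \<bar>real (m n) - real n\<bar> \<le> K * sqrt (real n)"
    using card_bound[OF assms] unfolding m_def by blast
  have "r \<in> o(\<lambda>n. real n)"
    unfolding r_def by (rule stirling_remainder[OF K]) (use hook_sum_tendsto in \<open>simp add: S_def\<close>)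
  moreover have "\<forall>\<^sub>F n in sequentially.
       - (1 + c_const a \<omega> \<pi>) * real n + r n
         \<le> ln (real (num_SYT (lam n) (\<mu> n))) - 1/2 * real n * ln (real n) \<and>
       ln (real (num_SYT (lam n) (\<mu> n))) - 1/2 * real n * ln (real n)
         \<le> - (1 + c_const a \<omega> \<pi>) * real n + ln (real (num_excited (lam n) (\<mu> n))) + r n"
    using eventually_gt_at_top[of 0]
  proof eventually_elim
    case (elim n)
    let ?e = "real (num_SYT (lam n) (\<mu> n))" and ?x = "real (num_excited (lam n) (\<mu> n))"
    have hook1: "real (hook (lam n) c) > 0" if "c \<in> skew_cells (lam n) (\<mu> n)" for c
      using hook_eq(2)[OF upper.part[of n], of "fst c" "snd c"] that
      by (auto simp: skew_cells_def)
    have H: "H n > 0" unfolding H_def using hook1 by (intro prod_pos) auto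
    have "ln (H n) = (\<Sum>c\<in>skew_cells (lam n) (\<mu> n). ln (real (hook (lam n) c)))"
      unfolding H_def using hook1 finite_skew by (intro ln_prod) auto
    also have "\<dots> = (\<Sum>c\<in>skew_cells (lam n) (\<mu> n). ln (real (hook (lam n) c) / sqrt (real n)) + 1/2 * ln (real n))"
      using hook1 elim by (intro sum.cong) (auto simp: ln_div ln_sqrt)
    also have "\<dots> = S n + 1/2 * real (m n) * ln (real n)"
      by (simp add: sum.distrib S_def m_def)
    finally have lnH: "ln (H n) = S n + 1/2 * real (m n) * ln (real n)" .
    note nb = naruse_bounds[OF skew[of n], folded m_def H_def]
    have "?e * H n > 0" using nb(1) by (rule less_le_trans[rotated]) simp
    then have e: "?e > 0" using H by (simp add: zero_less_mult_iff)
    have "ln (fact (m n)) \<le> ln (?e * H n)"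
      by (rule iffD2[OF ln_le_cancel_iff nb(1)]) (use \<open>?e * H n > 0\<close> in auto)
    then have 1: "ln (fact (m n)) \<le> ln ?e + ln (H n)" using e H by (simp add: ln_mult)
    have "ln (?e * H n) \<le> ln (fact (m n) * ?x)"
      by (rule iffD2[OF ln_le_cancel_iff nb(2)]) (use \<open>?e * H n > 0\<close> nb(3) in auto)
    then have 2: "ln ?e + ln (H n) \<le> ln (fact (m n)) + ln ?x" using e H nb(3) by (simp add: ln_mult)
    show ?case using 1 2 unfolding lnH r_def by (simp add: algebra_simps)
  qed
  ultimately show ?thesis by blast
qed

end

theorem theorem6p3:
  fixes a b :: real
    and \<omega> \<pi> :: "real \<Rightarrow> real"
    and lam \<mu> :: "nat \<Rightarrow> nat \<Rightarrow> nat"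
  assumes "\<omega> \<in> {0..a} \<rightarrow> {0..b}" and "\<pi> \<in> {0..a} \<rightarrow> {0..b}"
    and "continuous_on {0..a} \<omega>" and "continuous_on {0..a} \<pi>"
    and "antimono_on {0..a} \<omega>" and "antimono_on {0..a} \<pi>"
    and "\<And>x. x \<in> {0..a} \<Longrightarrow> \<pi> x \<le> \<omega> x"
    and "area (skew_region a \<omega> \<pi>) = 1"
    and "\<And>n. connected_skew_shape (lam n) (\<mu> n)"
    and "strongly_stable a \<omega> lam" and "strongly_stable a \<pi> \<mu>"
  shows "\<exists>r s :: nat \<Rightarrow> real. r \<in> o(\<lambda>n. real n) \<and> s \<in> o(\<lambda>n. real n) \<and>
    (\<forall>\<^sub>F n in sequentially.
       - (1 + c_const a \<omega> \<pi>) * real n + r n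
         \<le> ln (real (num_SYT (lam n) (\<mu> n))) - 1/2 * real n * ln (real n) \<and>
       ln (real (num_SYT (lam n) (\<mu> n))) - 1/2 * real n * ln (real n)
         \<le> - (1 + c_const a \<omega> \<pi>) * real n + ln (real (num_excited (lam n) (\<mu> n))) + s n)"
proof -
  \<comment> \<open>For \<open>a \<le> 0\<close> the region is empty or lies on a vertical line,
    contradicting area 1.\<close>
  have a: "0 < a"
  proof (rule ccontr)
    assume "\<not> 0 < a"
    then have sub: "skew_region a \<omega> \<pi> \<subseteq> {z. fst z = 0}" by (auto simp: skew_region_def)
    have "AE z in lborel. z \<notin> skew_region a \<omega> \<pi>"
      using AE_lborel_fst_neq[of 0] by eventually_elim (use sub in blast)
    then have "emeasure lborel {z \<in> space lborel. z \<in> skew_region a \<omega> \<pi>} = 0"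
      by (rule emeasure_eq_0_AE)
    then have "area (skew_region a \<omega> \<pi>) = 0" by (simp add: area_def measure_def)
    then show False using assms(8) by simp
  qed
  interpret stable_skew_shape a b \<omega> \<pi> lam \<mu>
    by unfold_locales (use assms a in \<open>auto simp: connected_skew_shape_def skew_shape_def\<close>)
  obtain r where "r \<in> o(\<lambda>n. real n)" "\<forall>\<^sub>F n in sequentially.
       - (1 + c_const a \<omega> \<pi>) * real n + r n
         \<le> ln (real (num_SYT (lam n) (\<mu> n))) - 1/2 * real n * ln (real n) \<and>
       ln (real (num_SYT (lam n) (\<mu> n))) - 1/2 * real n * ln (real n)
         \<le> - (1 + c_const a \<omega> \<pi>) * real n + ln (real (num_excited (lam n) (\<mu> n))) + r n"
    using num_SYT_asymptotics[OF assms(8)] by blast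
  then show ?thesis by blast
qed

end
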